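(* For any skew diagram $D$, with rows $1,\dots,r$ (numbered from top to bottom), columns $1,\dots,c$ (numbered from right to left), and associated bipartite poset $P_D$ on $\{x_1,\dots,x_r,y_1,\dots,y_c\}$, $$\Psi_{P_D}(\mathbf{x}) = \frac{ \sum_{\pi} \prod_{(i,j) \in D \setminus \pi} (x_i - y_j) }{ \prod_{(i,j) \in D} (x_i - y_j) },$$ where the sum in the numerator runs over all lattice paths $\pi$ from $(1,1)$ to $(r,c)$ inside $D$ that take steps either one unit south or west. In particular, when $\mu=\emptyset$, so that $D$ is the Ferrers diagram for a partition $\lambda=(\lambda_1,\dots,\lambda_r)$, this can be rewritten $$\Psi_{P_D}(\mathbf{x}) = \frac{\mathfrak{S}_{\hat w}(\mathbf{x},\mathbf{y})}{\mathfrak{S}_{w}(\mathbf{x},\mathbf{y})},$$ where $\mathfrak{S}_{w}(\mathbf{x},\mathbf{y}),\mathfrak{S}_{\hat w}(\mathbf{x},\mathbf{y})$ are the double Schubert polynomials for the dominant permutation $w$ having Lehmer code $\lambda=(\lambda_1,\dots,\lambda_r)$, and the vexillary permutation $\hat w$ having Lehmer code $\hat\lambda:=(0,\lambda_2-1,\dots,\lambda_r-1)$.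
   Context: A skew (Ferrers) diagram $D=\lambda/\mu$ is drawn in English notation as a collection of points $(i,j)$ in the plane, with rows numbered $1,2,\dots,r$ from top to bottom and columns numbered $1,2,\dots,c$ from right to left, so that the northeasternmost and southwesternmost points of $D$ are labelled $(1,1)$ and $(r,c)$, respectively. A south step is $(i,j)\to(i+1,j)$ and a west step is $(i,j)\to(i,j+1)$. The bipartite poset $P_D$ on the set $\{x_1,\dots,x_r,y_1,\dots,y_c\}$ has an order relation $x_i <_{P_D} y_j$ whenever $(i,j)$ is a point of $D$ (and no other strict relations). For a finite poset $P$ whose $N$ elements are variables, $\Psi_P := \sum \frac{1}{(z_1-z_2)(z_2-z_3)\cdots(z_{N-1}-z_N)}$, the sum running over all linear extensions of $P$, i.e. all listings $(z_1,\dots,z_N)$ of the elements such that $z_a<_P z_b$ implies $a<b$. For $P=P_D$ the variables are $x_1,\dots,x_r,y_1,\dots,y_c$. The Lehmer code of a permutation $w$ is $(c_1,c_2,\dots)$ with $c_i=\#\{j>i: w(j)<w(i)\}$ (trailing zeros may be omitted). Double Schubert polynomials in $\mathbf{x}=(x_1,x_2,\dots)$ and $\mathbf{y}=(y_1,y_2,\dots)$ are given by $\mathfrak{S}_{w_0}(\mathbf{x},\mathbf{y})=\prod_{i+j\le n}(x_i-y_j)$ for the longest element $w_0$ of the symmetric group on $n$ letters, and $\mathfrak{S}_{ws_i}=\partial_i\mathfrak{S}_w$ whenever $w(i)>w(i+1)$, where $\partial_i f = (f-s_if)/(x_i-x_{i+1})$ acts on the $x$ variables. A permutation is dominant if it is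 $132$-avoiding and vexillary if it is $2143$-avoiding.
   Formalization: With columns numbered from right to left the second formula is false (e.g. λ=(2,1)); the formal statement replaces y_j by y_{c+1-j} (1≤j≤c) in both double Schubert polynomials. D is assumed nonempty. *)

theory Defs
  imports
    Complex_Main
    "HOL-Library.Poly_Mapping"
    "HOL-Computational_Algebra.Fraction_Field"
    "HOL-Combinatorics.Permutations"
begin

datatype var = X nat | Y nat

text \<open>The order on variables is arbitrary; it only serves to make the type of polynomials
  an integral domain.\<close>

fun var_rank :: "var \<Rightarrow> nat" where
  "var_rank (X i) = 2 * i"
| "var_rank (Y j) = 2 * j + 1"

lemma var_rank_inject: "var_rank u = var_rank v \<Longrightarrow> u = v"
  by (cases u; cases v) (simp_all, presburger+)

instantiation var :: linorder
begin

definition less_eq_var :: "var \<Rightarrow> var \<Rightarrow> bool" where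
  "u \<le> v \<longleftrightarrow> var_rank u \<le> var_rank v"

definition less_var :: "var \<Rightarrow> var \<Rightarrow> bool" where
  "u < v \<longleftrightarrow> var_rank u < var_rank v"

instance
  by standard (auto simp: less_eq_var_def less_var_def intro: var_rank_inject)

end

text \<open>A monomial is a finitely supported exponent function; a polynomial is a finitely
  supported function from monomials to rational coefficients.\<close>

type_synonym mpoly = "(var \<Rightarrow>\<^sub>0 nat) \<Rightarrow>\<^sub>0 rat"
type_synonym ratfun = "mpoly fract"

definition pvar :: "var \<Rightarrow> mpoly" where
  "pvar v = Poly_Mapping.single (Poly_Mapping.single v 1) 1"

definition rf :: "mpoly \<Rightarrow> ratfun" where
  "rf p = Fract p 1"

definition rvar :: "var \<Rightarrow> ratfun" where
  "rvar v = rf (pvar v)"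

text \<open>Substitution of variables \<open>v \<mapsto> \<sigma> v\<close>, for involutions \<open>\<sigma>\<close> only: \<open>map_key\<close> is
  composition, so the coefficient of a monomial \<open>m\<close> in the result is the coefficient in \<open>f\<close>
  of the exponent function \<open>m \<circ> \<sigma>\<close>.\<close>

definition subst_invol :: "(var \<Rightarrow> var) \<Rightarrow> mpoly \<Rightarrow> mpoly" where
  "subst_invol \<sigma> f = Poly_Mapping.map_key (Poly_Mapping.map_key \<sigma>) f"

text \<open>A finite poset is given by its ground set \<open>V\<close> and its strict order relation \<open>R\<close>.\<close>

definition linear_extensions :: "'a set \<Rightarrow> ('a \<times> 'a) set \<Rightarrow> 'a list set" where
  "linear_extensions V R =
     {zs. distinct zs \<and> set zs = V \<and>
          (\<forall>a < length zs. \<forall>b < length zs. (zs ! a, zs ! b) \<in> R \<longrightarrow> a < b)}"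

definition Psi :: "var set \<Rightarrow> (var \<times> var) set \<Rightarrow> ratfun" where
  "Psi V R = (\<Sum>zs \<in> linear_extensions V R.
     1 / (\<Prod>a < length zs - 1. rvar (zs ! a) - rvar (zs ! Suc a)))"

text \<open>A partition is a function on the positive integers; the value at 0 is never used.\<close>

definition is_partition :: "(nat \<Rightarrow> nat) \<Rightarrow> bool" where
  "is_partition lam \<longleftrightarrow> (\<forall>i\<ge>1. lam (Suc i) \<le> lam i) \<and> (\<exists>m. \<forall>i>m. lam i = 0)"

text \<open>The cells of \<open>lam/mu\<close> in matrix coordinates: rows from top to bottom, columns from
  left to right.\<close>

definition cells :: "(nat \<Rightarrow> nat) \<Rightarrow> (nat \<Rightarrow> nat) \<Rightarrow> (nat \<times> nat) set" where
  "cells lam mu = {(i, k). 1 \<le> i \<and> mu i < k \<and> k \<le> lam i}"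

definition top_row :: "(nat \<Rightarrow> nat) \<Rightarrow> (nat \<Rightarrow> nat) \<Rightarrow> nat" where
  "top_row lam mu = Min (fst ` cells lam mu)"

definition right_col :: "(nat \<Rightarrow> nat) \<Rightarrow> (nat \<Rightarrow> nat) \<Rightarrow> nat" where
  "right_col lam mu = Max (snd ` cells lam mu)"

definition num_rows :: "(nat \<Rightarrow> nat) \<Rightarrow> (nat \<Rightarrow> nat) \<Rightarrow> nat" where
  "num_rows lam mu = Max (fst ` cells lam mu) + 1 - top_row lam mu"

definition num_cols :: "(nat \<Rightarrow> nat) \<Rightarrow> (nat \<Rightarrow> nat) \<Rightarrow> nat" where
  "num_cols lam mu = right_col lam mu + 1 - Min (snd ` cells lam mu)"

text \<open>The diagram itself, relabelled: rows are numbered downwards from the topmost occupied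
  row and columns leftwards from the rightmost occupied column, so that the northeasternmost
  point is \<open>(1, 1)\<close> and the southwesternmost one is \<open>(num_rows lam mu, num_cols lam mu)\<close>.\<close>

definition skew_diagram :: "(nat \<Rightarrow> nat) \<Rightarrow> (nat \<Rightarrow> nat) \<Rightarrow> (nat \<times> nat) set" where
  "skew_diagram lam mu =
     (\<lambda>(i, k). (i + 1 - top_row lam mu, right_col lam mu + 1 - k)) ` cells lam mu"

definition poset_elements :: "nat \<Rightarrow> nat \<Rightarrow> var set" where
  "poset_elements r c = X ` {1..r} \<union> Y ` {1..c}"

definition poset_order :: "(nat \<times> nat) set \<Rightarrow> (var \<times> var) set" where
  "poset_order D = {(X i, Y j) | i j. (i, j) \<in> D}"

definition sw_step :: "nat \<times> nat \<Rightarrow> nat \<times> nat \<Rightarrow> bool" where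
  "sw_step p q \<longleftrightarrow> q = (fst p + 1, snd p) \<or> q = (fst p, snd p + 1)"

definition lattice_paths :: "(nat \<times> nat) set \<Rightarrow> nat \<Rightarrow> nat \<Rightarrow> (nat \<times> nat) list set" where
  "lattice_paths D r c =
     {p. p \<noteq> [] \<and> hd p = (1, 1) \<and> last p = (r, c) \<and> set p \<subseteq> D \<and> successively sw_step p}"

text \<open>Permutations of the positive integers fixing all but finitely many of them; they are
  represented as functions on \<open>nat\<close> that fix 0.\<close>

definition is_perm :: "(nat \<Rightarrow> nat) \<Rightarrow> bool" where
  "is_perm w \<longleftrightarrow> (\<exists>n. w permutes {1..n})"

definition lehmer_code :: "(nat \<Rightarrow> nat) \<Rightarrow> nat \<Rightarrow> nat" where
  "lehmer_code w i = card {j. i < j \<and> w j < w i}"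

definition has_code :: "(nat \<Rightarrow> nat) \<Rightarrow> (nat \<Rightarrow> nat) \<Rightarrow> bool" where
  "has_code w c \<longleftrightarrow> is_perm w \<and> (\<forall>i\<ge>1. lehmer_code w i = c i)"

definition dominant :: "(nat \<Rightarrow> nat) \<Rightarrow> bool" where
  "dominant w \<longleftrightarrow>
     \<not> (\<exists>a b c. 1 \<le> a \<and> a < b \<and> b < c \<and> w a < w c \<and> w c < w b)"

definition vexillary :: "(nat \<Rightarrow> nat) \<Rightarrow> bool" where
  "vexillary w \<longleftrightarrow>
     \<not> (\<exists>a b c d. 1 \<le> a \<and> a < b \<and> b < c \<and> c < d \<and> w b < w a \<and> w a < w d \<and> w d < w c)"

definition longest_perm :: "nat \<Rightarrow> nat \<Rightarrow> nat" where
  "longest_perm n i = (if 1 \<le> i \<and> i \<le> n then n + 1 - i else i)"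

text \<open>The quotient of \<open>f - s\<^sub>i f\<close> by \<open>x\<^sub>i - x\<^sub>i\<^sub>+\<^sub>1\<close>; it exists for every
  polynomial \<open>f\<close>, and is unique because \<open>mpoly\<close> is an integral domain.\<close>

definition divided_difference :: "nat \<Rightarrow> mpoly \<Rightarrow> mpoly" where
  "divided_difference i f =
     (THE g. (pvar (X i) - pvar (X (Suc i))) * g
           = f - subst_invol (transpose (X i) (X (Suc i))) f)"

inductive double_schubert_rel :: "(nat \<Rightarrow> nat) \<Rightarrow> mpoly \<Rightarrow> bool" where
  longest: "double_schubert_rel (longest_perm n)
     (\<Prod>(i, j) \<in> {(i, j). 1 \<le> i \<and> 1 \<le> j \<and> i + j \<le> n}. pvar (X i) - pvar (Y j))"
| step: "double_schubert_rel w f \<Longrightarrow> 1 \<le> i \<Longrightarrow> w (Suc i) < w i \<Longrightarrow>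
     double_schubert_rel (w \<circ> transpose i (Suc i)) (divided_difference i f)"

text \<open>The relation is single-valued and total on permutations by the classical facts that divided
  differences satisfy the braid relations and that the polynomial of the longest element of the
  symmetric group on \<open>n\<close> letters arises from that on \<open>n + 1\<close> letters.\<close>

definition double_schubert :: "(nat \<Rightarrow> nat) \<Rightarrow> mpoly" where
  "double_schubert w = (THE f. double_schubert_rel w f)"

text \<open>The classical product formula for a dominant permutation with code \<open>lam\<close> attaches the
  \<open>j\<close>-th y-variable to the \<open>j\<close>-th column from the left, whereas \<open>skew_diagram\<close> numbers columns
  from the right. The following substitution, exchanging \<open>y\<^sub>j\<close> with the variable \<open>y\<close> of index
  \<open>c + 1 - j\<close>, translates between the two numberings of \<open>c\<close> columns.\<close>

definition reverse_cols :: "nat \<Rightarrow> var \<Rightarrow> var" where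
  "reverse_cols c v =
     (case v of X i \<Rightarrow> X i | Y j \<Rightarrow> if 1 \<le> j \<and> j \<le> c then Y (c + 1 - j) else Y j)"

text \<open>The code \<open>(0, lam\<^sub>2 - 1, \<dots>, lam\<^sub>r - 1)\<close>; beyond the \<open>r\<close> nonzero parts truncated
  subtraction gives 0.\<close>

definition hat_code :: "(nat \<Rightarrow> nat) \<Rightarrow> nat \<Rightarrow> nat" where
  "hat_code lam i = (if i \<le> 1 then 0 else lam i - 1)"

end

theory Submission
  imports Defs
begin


text \<open>The path formula comes from one identity for arbitrary finite posets. Let \<open>u\<close> and \<open>v\<close> be
elements of \<open>V\<close>. Along a linear extension \<open>u - v\<close> is a signed sum of differences of
neighbours, and cancelling one such difference against the denominator cuts the extension into an
extension of an order ideal \<open>A\<close> and one of its complement. Hence \<open>(u - v) * Psi V\<close> is the sum of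
\<open>\<plusminus> Psi A * Psi (V - A)\<close> over the ideals \<open>A\<close> that separate \<open>u\<close> from \<open>v\<close> (\<open>Psi_cut\<close>).

This identity has two consequences. If the poset is a disjoint union of two parts and \<open>u\<close>, \<open>v\<close> lie
in different parts, then by induction all terms vanish except those of the two parts themselves, and
these cancel; so \<open>Psi\<close> of a disconnected poset is zero (\<open>Psi_disconnected\<close>). If \<open>(a, b)\<close> is the
northeastern corner of a skew diagram, \<open>u = x\<^sub>a\<close> and \<open>v = y\<^sub>b\<close>, then order convexity of the diagram
leaves only the cuts that split off \<open>x\<^sub>a\<close> or \<open>y\<^sub>b\<close> alone (\<open>Psi_corner\<close>). So
\<open>(x\<^sub>a - y\<^sub>b) * Psi\<close> is the sum of the two values of \<open>Psi\<close> after the first row or the first column is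
deleted. The sum over lattice paths of \<open>\<Prod> 1 / (x\<^sub>i - y\<^sub>j)\<close> over the cells visited satisfies the same
recursion, according to the first step of the path (\<open>Psi_eq_path_sum\<close>).

For Ferrers diagrams both Schubert polynomials are computed by divided differences. That the defining
relation is single-valued follows from a diamond argument: two different last steps
of a derivation are completed to a common ancestor by the braid and commutation relations
(\<open>schubert_in_unique\<close>). Removing a box from the first of two adjacent rows whose lengths differ by
one is a divided difference, and leads from the staircase to every smaller partition; this gives the
product formula for dominant permutations (\<open>schubert_of_partition_code\<close>). From the dominant
permutation with code \<open>(\<lambda>\<^sub>2, \<dots>, \<lambda>\<^sub>r)\<close> the operators \<open>\<partial>\<^sub>r\<^sub>-\<^sub>1, \<dots>, \<partial>\<^sub>1\<close> lead to the code
\<open>(0, \<lambda>\<^sub>2 - 1, \<dots>, \<lambda>\<^sub>r - 1)\<close>; each of them sums over the column in which a path leaves one row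
(\<open>divided_difference_path_poly\<close>), and the result is the sum over paths of products over unvisited
cells, with columns numbered from the left.\<close>

section \<open>Polynomials as rational functions\<close>

lemma pvar_inject [simp]: "pvar u = pvar v \<longleftrightarrow> u = v"
proof
  assume "pvar u = pvar v"
  then have "Poly_Mapping.keys (pvar u) = Poly_Mapping.keys (pvar v)" by simp
  then have "Poly_Mapping.single u (1::nat) = Poly_Mapping.single v 1"
    by (simp add: pvar_def)
  then have "Poly_Mapping.keys (Poly_Mapping.single u (1::nat)) = Poly_Mapping.keys (Poly_Mapping.single v (1::nat))"
    by simp
  then show "u = v" by simp
qed simp

lemma rf_add: "rf (p + q) = rf p + rf q" by (simp add: rf_def)
lemma rf_diff: "rf (p - q) = rf p - rf q" by (simp add: rf_def)
lemma rf_mult: "rf (p * q) = rf p * rf q" by (simp add: rf_def)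
lemma rf_1 [simp]: "rf 1 = 1" by (simp add: rf_def One_fract_def)
lemma rf_eq_iff [simp]: "rf p = rf q \<longleftrightarrow> p = q" by (simp add: rf_def eq_fract)

lemma rf_prod: "rf (prod f A) = (\<Prod>x\<in>A. rf (f x))"
  by (induction A rule: infinite_finite_induct) (simp_all add: rf_mult)

lemma rvar_inject [simp]: "rvar u = rvar v \<longleftrightarrow> u = v"
  by (simp add: rvar_def)

section \<open>Linear extension sums\<close>

definition chain_denom :: "var list \<Rightarrow> ratfun" where
  "chain_denom zs = (\<Prod>a < length zs - 1. rvar (zs ! a) - rvar (zs ! Suc a))"

lemma chain_denom_singleton [simp]: "chain_denom [z] = 1"
  by (simp add: chain_denom_def)

lemma chain_denom_Cons_Cons:
  "chain_denom (x # y # zs) = (rvar x - rvar y) * chain_denom (y # zs)"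
  by (simp add: chain_denom_def prod.lessThan_Suc_shift del: prod.lessThan_Suc)

lemma chain_denom_append:
  "xs \<noteq> [] \<Longrightarrow> ys \<noteq> [] \<Longrightarrow>
     chain_denom (xs @ ys) = chain_denom xs * (rvar (last xs) - rvar (hd ys)) * chain_denom ys"
proof (induction xs)
  case (Cons x xs)
  show ?case
  proof (cases xs)
    case Nil
    then show ?thesis using Cons.prems by (cases ys) (simp_all add: chain_denom_Cons_Cons)
  next
    case (Cons x' xs')
    then show ?thesis using Cons.IH Cons.prems by (simp add: chain_denom_Cons_Cons)
  qed
qed simp

text \<open>The prefixes that contain \<open>u\<close> are those that end at \<open>u\<close> or later, so the sum telescopes from \<open>u\<close> to
the last entry. Subtracting two instances yields \<open>u - v\<close> without distinguishing which of the two
elements comes first.\<close>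

lemma telescope_prefixes:
  assumes "distinct zs" and "u \<in> set zs"
  shows "(\<Sum>s < length zs - 1. of_bool (u \<in> set (take (Suc s) zs)) *
            (rvar (zs ! s) - rvar (zs ! Suc s))) = rvar u - rvar (last zs)"
proof -
  obtain k where k: "k < length zs" "zs ! k = u"
    using assms(2) by (auto simp: in_set_conv_nth)
  have mem: "u \<in> set (take (Suc s) zs) \<longleftrightarrow> k \<le> s" if "s < length zs - 1" for s
    using k assms(1) that by (auto simp: in_set_conv_nth nth_eq_iff_index_eq less_Suc_eq_le)
  have "(\<Sum>s < length zs - 1. of_bool (u \<in> set (take (Suc s) zs)) *
            (rvar (zs ! s) - rvar (zs ! Suc s)))
        = (\<Sum>s \<in> {k..<length zs - 1}. rvar (zs ! s) - rvar (zs ! Suc s))"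
    by (rule sum.mono_neutral_cong_right) (auto simp: mem)
  also have "\<dots> = - (\<Sum>s \<in> {k..<length zs - 1}. rvar (zs ! Suc s) - rvar (zs ! s))"
    by (simp add: sum_negf [symmetric])
  also have "\<dots> = rvar (zs ! k) - rvar (zs ! (length zs - 1))"
    using k by (subst sum_Suc_diff') auto
  also have "\<dots> = rvar u - rvar (last zs)"
    using k by (subst last_conv_nth) auto
  finally show ?thesis .
qed

text \<open>The definition by positions turned into a form that splits over concatenation. Irreflexivity has to be
stated separately, because a pair \<open>(x, x)\<close> in the relation rules out every listing.\<close>

lemma linear_extensions_iff:
  "zs \<in> linear_extensions V R \<longleftrightarrow>
     distinct zs \<and> set zs = V \<and> (\<forall>x\<in>V. (x, x) \<notin> R) \<and> sorted_wrt (\<lambda>x y. (y, x) \<notin> R) zs"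
  (is "?l \<longleftrightarrow> ?r")
proof
  assume "?l"
  then have *: "distinct zs \<and> set zs = V \<and>
          (\<forall>a < length zs. \<forall>b < length zs. (zs ! a, zs ! b) \<in> R \<longrightarrow> a < b)"
    unfolding linear_extensions_def by (rule CollectD)
  have "(x, x) \<notin> R" if "x \<in> V" for x
  proof
    assume R: "(x, x) \<in> R"
    have "\<exists>a. a < length zs \<and> zs ! a = x"
      using that * by (simp add: in_set_conv_nth [symmetric])
    then show False using * R by fastforce
  qed
  moreover have "(zs ! b, zs ! a) \<notin> R" if "a < b" "b < length zs" for a b
  proof
    assume "(zs ! b, zs ! a) \<in> R"
    moreover have "a < length zs" using that by simp
    ultimately have "b < a" using * that(2) by metis
    then show False using that(1) by simp
  qed
  ultimately show ?r
    using * by (simp add: sorted_wrt_iff_nth_less)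
next
  assume r: ?r
  have "a < b" if "a < length zs" "b < length zs" "(zs ! a, zs ! b) \<in> R" for a b
  proof (rule ccontr)
    assume "\<not> a < b"
    then consider "a = b" | "b < a" by linarith
    then show False
      using r that by cases (auto simp: sorted_wrt_iff_nth_less)
  qed
  then show ?l using r by (simp add: linear_extensions_def)
qed

lemma finite_linear_extensions: "finite V \<Longrightarrow> finite (linear_extensions V R)"
  by (rule finite_subset [OF _ finite_subset_distinct [of V]]) (auto simp: linear_extensions_def)

lemma Psi_eq: "Psi V R = (\<Sum>zs \<in> linear_extensions V R. 1 / chain_denom zs)"
  by (simp add: Psi_def chain_denom_def)

lemma Psi_singleton: "(u, u) \<notin> R \<Longrightarrow> Psi {u} R = 1"
proof -
  assume "(u, u) \<notin> R"
  have "zs = [u]" if "distinct zs" "set zs = {u}" for zs :: "var list"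
    using that by (cases zs; cases "tl zs") auto
  then have "linear_extensions {u} R = {[u]}"
    using \<open>(u, u) \<notin> R\<close> by (auto simp: linear_extensions_iff)
  then show ?thesis by (simp add: Psi_eq)
qed

definition ideals :: "'a set \<Rightarrow> ('a \<times> 'a) set \<Rightarrow> 'a set set" where
  "ideals V R = {A. A \<subseteq> V \<and> (\<forall>a\<in>V. \<forall>b\<in>A. (a, b) \<in> R \<longrightarrow> a \<in> A)}"

lemma append_in_linear_extensions_iff:
  "xs @ ys \<in> linear_extensions V R \<longleftrightarrow>
     set xs \<in> ideals V R \<and> xs \<in> linear_extensions (set xs) R \<and> ys \<in> linear_extensions (V - set xs) R"
  (is "?l \<longleftrightarrow> ?r")
proof
  assume l: ?l
  then have "set xs \<inter> set ys = {}" "V = set xs \<union> set ys"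
    by (auto simp: linear_extensions_iff)
  then show ?r
    using l by (auto simp: linear_extensions_iff ideals_def sorted_wrt_append)
next
  assume r: ?r
  then have "set xs \<subseteq> V" and ys: "set ys = V - set xs"
    and down: "\<And>a b. a \<in> V \<Longrightarrow> b \<in> set xs \<Longrightarrow> (a, b) \<in> R \<Longrightarrow> a \<in> set xs"
    by (auto simp: linear_extensions_iff ideals_def)
  have "(b, a) \<notin> R" if "a \<in> set xs" "b \<in> set ys" for a b
    using down [of b a] that ys by auto
  moreover have "set (xs @ ys) = V" using \<open>set xs \<subseteq> V\<close> ys by auto
  ultimately show ?l
    using r ys by (auto simp: linear_extensions_iff sorted_wrt_append)
qed

text \<open>The sign is positive for ideals that contain \<open>u\<close> but not \<open>v\<close>, negative for those that contain \<open>v\<close>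
but not \<open>u\<close>, and zero for the others. The pairs of an ideal and two linear extensions correspond to
the linear extensions of \<open>V\<close> with a chosen cutting position.\<close>

lemma Psi_cut:
  assumes V: "finite V" and u: "u \<in> V" and v: "v \<in> V"
  shows "(rvar u - rvar v) * Psi V R =
     (\<Sum>A \<in> ideals V R - {{}, V}.
        (of_bool (u \<in> A) - of_bool (v \<in> A)) * (Psi A R * Psi (V - A) R))"
proof -
  define L where "L = linear_extensions V R"
  define e :: "var set \<Rightarrow> ratfun" where "e A = of_bool (u \<in> A) - of_bool (v \<in> A)" for A
  define I where "I = ideals V R - {{}, V}"
  have finI: "finite I"
    by (rule finite_subset [of _ "Pow V"]) (use V in \<open>auto simp: I_def ideals_def\<close>)
  have len: "length zs = card V" if "zs \<in> L" for zs
    using that distinct_card by (fastforce simp: L_def linear_extensions_iff)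
  have one: "(rvar u - rvar v) / chain_denom zs =
      (\<Sum>s < card V - 1. e (set (take (Suc s) zs)) /
          (chain_denom (take (Suc s) zs) * chain_denom (drop (Suc s) zs)))"
    if zs: "zs \<in> L" for zs
  proof -
    have dist: "distinct zs" and set: "set zs = V"
      using zs by (auto simp: L_def linear_extensions_iff)
    have "rvar u - rvar v = (rvar u - rvar (last zs)) - (rvar v - rvar (last zs))"
      by simp
    also have "\<dots> = (\<Sum>s < length zs - 1. e (set (take (Suc s) zs)) *
                        (rvar (zs ! s) - rvar (zs ! Suc s)))"
      using dist set u v
      by (simp only: telescope_prefixes [symmetric] e_def left_diff_distrib sum_subtractf)
    finally have "(rvar u - rvar v) / chain_denom zs =
       (\<Sum>s < length zs - 1. e (set (take (Suc s) zs)) *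
                        (rvar (zs ! s) - rvar (zs ! Suc s)) / chain_denom zs)"
      by (simp add: sum_divide_distrib)
    \<comment> \<open>The factor \<open>z\<^sub>s - z\<^sub>s\<^sub>+\<^sub>1\<close> of the denominator cancels; what is left belongs to the two pieces.\<close>
    also have "\<dots> = (\<Sum>s < length zs - 1. e (set (take (Suc s) zs)) /
          (chain_denom (take (Suc s) zs) * chain_denom (drop (Suc s) zs)))"
    proof (rule sum.cong)
      fix s assume "s \<in> {..<length zs - 1}"
      then have s: "Suc s < length zs" by auto
      have "chain_denom zs = chain_denom (take (Suc s) zs) *
              (rvar (zs ! s) - rvar (zs ! Suc s)) * chain_denom (drop (Suc s) zs)"
      proof -
        have "take (Suc s) zs \<noteq> []" "drop (Suc s) zs \<noteq> []" using s by auto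
        moreover have "last (take (Suc s) zs) = zs ! s"
          using s by (simp add: take_Suc_conv_app_nth)
        moreover have "hd (drop (Suc s) zs) = zs ! Suc s"
          using s by (simp add: hd_drop_conv_nth)
        ultimately show ?thesis
          using chain_denom_append [of "take (Suc s) zs" "drop (Suc s) zs"] by simp
      qed
      moreover have "rvar (zs ! s) - rvar (zs ! Suc s) \<noteq> 0"
        using s dist by (simp add: nth_eq_iff_index_eq)
      ultimately show "e (set (take (Suc s) zs)) * (rvar (zs ! s) - rvar (zs ! Suc s)) / chain_denom zs
          = e (set (take (Suc s) zs)) /
            (chain_denom (take (Suc s) zs) * chain_denom (drop (Suc s) zs))"
        by simp
    qed simp
    finally show ?thesis using len [OF zs] by simp
  qed
  have "(rvar u - rvar v) * Psi V R = (\<Sum>zs\<in>L. (rvar u - rvar v) / chain_denom zs)"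
    by (simp add: Psi_eq L_def sum_distrib_left)
  also have "\<dots> = (\<Sum>(zs, s) \<in> L \<times> {..<card V - 1}. e (set (take (Suc s) zs)) /
          (chain_denom (take (Suc s) zs) * chain_denom (drop (Suc s) zs)))"
    by (simp add: one sum.cartesian_product)
  also have "\<dots> = (\<Sum>(A, xs, ys) \<in> (SIGMA A:I. linear_extensions A R \<times> linear_extensions (V - A) R).
       e A / (chain_denom xs * chain_denom ys))"
  proof (rule sum.reindex_bij_witness [where
        i = "\<lambda>(A, xs, ys). (xs @ ys, length xs - 1)" and
        j = "\<lambda>(zs, s). (set (take (Suc s) zs), take (Suc s) zs, drop (Suc s) zs)"], goal_cases)
    case (1 p)
    then show ?case by (auto simp: len)
  next
    case (2 p)
    then obtain zs s where p: "p = (zs, s)" and zs: "zs \<in> L" and s: "s < card V - 1" by auto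
    have mem: "take (Suc s) zs @ drop (Suc s) zs \<in> linear_extensions V R"
      using zs by (simp add: L_def)
    define xs ys where "xs = take (Suc s) zs" and "ys = drop (Suc s) zs"
    have "xs \<noteq> []" "ys \<noteq> []"
      using s len [OF zs] by (auto simp: xs_def ys_def)
    then obtain x y where "x \<in> set xs" "y \<in> set ys"
      by (meson last_in_set)
    moreover have "set xs \<inter> set ys = {}" "set ys \<subseteq> V"
      using mem by (auto simp: linear_extensions_iff xs_def [symmetric] ys_def [symmetric])
    ultimately have "set (take (Suc s) zs) \<noteq> {}" "set (take (Suc s) zs) \<noteq> V"
      unfolding xs_def [symmetric] by auto
    then show ?case using mem unfolding p I_def append_in_linear_extensions_iff by simp
  next
    case (3 p)
    then obtain A xs ys where p: "p = (A, xs, ys)" and A: "A \<in> I"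
      and "xs \<in> linear_extensions A R" and "ys \<in> linear_extensions (V - A) R" by auto
    then have "set xs = A" "xs \<noteq> []" by (auto simp: linear_extensions_iff I_def)
    then show ?case by (auto simp: p)
  next
    case (4 p)
    then obtain A xs ys where p: "p = (A, xs, ys)" and A: "A \<in> I"
      and xs: "xs \<in> linear_extensions A R" and ys: "ys \<in> linear_extensions (V - A) R" by auto
    have sx: "set xs = A" "set ys = V - A" using xs ys by (auto simp: linear_extensions_iff)
    have ne: "xs \<noteq> []" "ys \<noteq> []" using sx A by (auto simp: I_def ideals_def)
    have mem: "xs @ ys \<in> L"
      using A xs ys sx by (auto simp: L_def I_def append_in_linear_extensions_iff)
    have "length xs - 1 < card V - 1"
      using len [OF mem] ne by (cases xs; cases ys) auto
    then show ?case using mem by (simp add: p)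
  qed auto
  also have "\<dots> = (\<Sum>A\<in>I. \<Sum>(xs, ys) \<in> linear_extensions A R \<times> linear_extensions (V - A) R.
       e A / (chain_denom xs * chain_denom ys))"
  proof (subst sum.Sigma)
    show "\<forall>A\<in>I. finite (linear_extensions A R \<times> linear_extensions (V - A) R)"
      using V by (auto simp: I_def ideals_def intro!: finite_linear_extensions
          intro: finite_subset)
  qed (use finI in \<open>auto simp: split_def\<close>)
  also have "\<dots> = (\<Sum>A\<in>I. e A * (Psi A R * Psi (V - A) R))"
  proof (rule sum.cong)
    fix A
    have "Psi A R * Psi (V - A) R = (\<Sum>xs\<in>linear_extensions A R. \<Sum>ys\<in>linear_extensions (V - A) R.
            1 / chain_denom xs * (1 / chain_denom ys))"
      unfolding Psi_eq by (rule sum_product)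
    also have "\<dots> = (\<Sum>(xs, ys) \<in> linear_extensions A R \<times> linear_extensions (V - A) R.
            1 / chain_denom xs * (1 / chain_denom ys))"
      by (rule sum.cartesian_product)
    finally show "(\<Sum>(xs, ys) \<in> linear_extensions A R \<times> linear_extensions (V - A) R.
            e A / (chain_denom xs * chain_denom ys)) = e A * (Psi A R * Psi (V - A) R)"
      by (simp add: sum_distrib_left split_def)
  qed simp
  finally show ?thesis by (simp add: e_def I_def)
qed

text \<open>Cut with \<open>u\<close> in one part and \<open>v\<close> in the other. A term survives only if neither the ideal nor its
complement meets both parts, hence only for the ideals \<open>V1\<close> and \<open>V2\<close>. They contribute the same
product with opposite signs.\<close>

lemma Psi_disconnected:
  assumes "finite V" and "V = V1 \<union> V2" and "V1 \<inter> V2 = {}" and "V1 \<noteq> {}" and "V2 \<noteq> {}"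
    and "\<And>a b. a \<in> V1 \<Longrightarrow> b \<in> V2 \<Longrightarrow> (a, b) \<notin> R \<and> (b, a) \<notin> R"
  shows "Psi V R = 0"
  using assms
proof (induction "card V" arbitrary: V V1 V2 rule: less_induct)
  case less
  obtain u v where u: "u \<in> V1" and v: "v \<in> V2"
    using less.prems by blast
  define T where "T A = (of_bool (u \<in> A) - of_bool (v \<in> A)) * (Psi A R * Psi (V - A) R)" for A
  have split0: "Psi A R = 0" if "A \<subseteq> V" "A \<noteq> V" "A \<inter> V1 \<noteq> {}" "A \<inter> V2 \<noteq> {}" for A
  proof (rule less.hyps [of A "A \<inter> V1" "A \<inter> V2"])
    show "card A < card V"
      using that less.prems(1) by (intro psubset_card_mono) auto
    show "finite A" using that less.prems(1) finite_subset by blast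
    show "(a, b) \<notin> R \<and> (b, a) \<notin> R" if "a \<in> A \<inter> V1" "b \<in> A \<inter> V2" for a b
      using that less.prems(6) [of a b] by auto
  qed (use that less.prems in auto)
  have "(rvar u - rvar v) * Psi V R = (\<Sum>A \<in> ideals V R - {{}, V}. T A)"
    unfolding T_def using less.prems u v by (intro Psi_cut) auto
  also have "\<dots> = (\<Sum>A \<in> {V1, V2}. T A)"
  proof (rule sum.mono_neutral_right)
    show "finite (ideals V R - {{}, V})"
      by (rule finite_subset [of _ "Pow V"]) (use less.prems in \<open>auto simp: ideals_def\<close>)
    show "{V1, V2} \<subseteq> ideals V R - {{}, V}"
      using less.prems by (auto simp: ideals_def)
    show "\<forall>A \<in> ideals V R - {{}, V} - {V1, V2}. T A = 0"
    proof
      fix A assume A: "A \<in> ideals V R - {{}, V} - {V1, V2}"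
      then have "A \<subseteq> V" "A \<noteq> {}" "A \<noteq> V" "A \<noteq> V1" "A \<noteq> V2" by (auto simp: ideals_def)
      then have "(A \<inter> V1 \<noteq> {} \<and> A \<inter> V2 \<noteq> {}) \<or> ((V - A) \<inter> V1 \<noteq> {} \<and> (V - A) \<inter> V2 \<noteq> {})"
      proof (cases "A \<inter> V1 = {}")
        case True
        then have "A \<subseteq> V2" using \<open>A \<subseteq> V\<close> less.prems(2) by auto
        then show ?thesis
          using True \<open>A \<noteq> V2\<close> less.prems(2,4) by auto
      next
        case False
        show ?thesis
        proof (cases "A \<inter> V2 = {}")
          case True
          then have "A \<subseteq> V1" using \<open>A \<subseteq> V\<close> less.prems(2) by auto
          then show ?thesis
            using True \<open>A \<noteq> V1\<close> less.prems(2,5) by auto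
        qed (use False in simp)
      qed
      moreover have "V - A \<noteq> V" using \<open>A \<noteq> {}\<close> \<open>A \<subseteq> V\<close> by blast
      ultimately have "Psi A R = 0 \<or> Psi (V - A) R = 0"
        using split0 [of A] split0 [of "V - A"] \<open>A \<subseteq> V\<close> \<open>A \<noteq> V\<close> by blast
      then show "T A = 0" by (auto simp: T_def)
    qed
  qed
  also have "\<dots> = T V1 + T V2"
  proof -
    have "V1 \<noteq> V2" using less.prems(3) u by auto
    then show ?thesis by simp
  qed
  also have "\<dots> = 0"
  proof -
    have "V - V1 = V2" "V - V2 = V1" "u \<notin> V2" "v \<notin> V1" using less.prems u v by auto
    then show ?thesis using u v by (simp add: T_def)
  qed
  finally show ?case using u v less.prems by auto
qed

lemma Psi_isolated:
  assumes "finite V" "u \<in> V" "V \<noteq> {u}" "\<And>w. w \<in> V \<Longrightarrow> (u, w) \<notin> R \<and> (w, u) \<notin> R"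
  shows "Psi V R = 0"
  using assms by (intro Psi_disconnected [of V "{u}" "V - {u}"]) auto


section \<open>Lattice paths\<close>

text \<open>Lattice paths between arbitrary cells: the recursion by the first step moves the starting cell.\<close>

definition paths :: "(nat \<times> nat) set \<Rightarrow> nat \<times> nat \<Rightarrow> nat \<times> nat \<Rightarrow> (nat \<times> nat) list set" where
  "paths D p q =
     {\<pi>. \<pi> \<noteq> [] \<and> hd \<pi> = p \<and> last \<pi> = q \<and> set \<pi> \<subseteq> D \<and> successively sw_step \<pi>}"

abbreviation cell_factor :: "nat \<times> nat \<Rightarrow> ratfun" where
  "cell_factor p \<equiv> rvar (X (fst p)) - rvar (Y (snd p))"

definition path_sum :: "(nat \<times> nat) set \<Rightarrow> nat \<times> nat \<Rightarrow> nat \<times> nat \<Rightarrow> ratfun" where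
  "path_sum D p q = (\<Sum>\<pi>\<in>paths D p q. \<Prod>z\<in>set \<pi>. 1 / cell_factor z)"

lemma sw_path_increasing:
  "successively sw_step (p # \<pi>) \<Longrightarrow> z \<in> set \<pi> \<Longrightarrow> fst p + snd p < fst z + snd z"
proof (induction \<pi> arbitrary: p)
  case (Cons q \<pi>)
  have "fst p + snd p < fst q + snd q"
    using Cons.prems(1) by (auto simp: sw_step_def)
  moreover have "z = q \<or> fst q + snd q < fst z + snd z"
    using Cons by auto
  ultimately show ?case by auto
qed simp

lemma sw_path_distinct: "successively sw_step \<pi> \<Longrightarrow> distinct \<pi>"
proof (induction \<pi>)
  case (Cons p \<pi>)
  have "p \<notin> set \<pi>" using sw_path_increasing [OF Cons.prems] by blast
  then show ?case using Cons by (cases \<pi>) auto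
qed simp

lemma finite_paths: "finite D \<Longrightarrow> finite (paths D p q)"
  by (rule finite_subset [OF _ finite_subset_distinct [of D]])
     (auto simp: paths_def intro: sw_path_distinct)

text \<open>In the recursion below, a first step that leaves the diagram therefore contributes nothing, and no case
distinction is necessary.\<close>

lemma path_sum_outside: "p \<notin> D \<Longrightarrow> path_sum D p q = 0"
proof -
  assume "p \<notin> D"
  then have "paths D p q = {}" by (auto simp: paths_def neq_Nil_conv)
  then show ?thesis by (simp add: path_sum_def)
qed

lemma path_sum_end: "q \<in> D \<Longrightarrow> path_sum D q q = 1 / cell_factor q"
proof -
  assume q: "q \<in> D"
  have "\<pi> = [q]" if \<pi>: "\<pi> \<in> paths D q q" for \<pi>
  proof -
    obtain \<pi>' where eq: "\<pi> = q # \<pi>'"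
      using \<pi> by (cases \<pi>) (auto simp: paths_def)
    have "\<pi>' = []"
    proof (rule ccontr)
      assume "\<pi>' \<noteq> []"
      then have "q \<in> set \<pi>'" using \<pi> eq last_in_set [of \<pi>'] by (simp add: paths_def)
      then show False using sw_path_increasing [of q \<pi>' q] \<pi> eq by (simp add: paths_def)
    qed
    then show ?thesis using eq by simp
  qed
  moreover have "[q] \<in> paths D q q" using q by (simp add: paths_def)
  ultimately have "paths D q q = {[q]}" by blast
  then show ?thesis by (simp add: path_sum_def)
qed

lemma path_sum_step:
  assumes D: "finite D" and p: "p \<in> D" and pq: "p \<noteq> q"
  shows "path_sum D p q =
     (path_sum D (fst p + 1, snd p) q + path_sum D (fst p, snd p + 1) q) / cell_factor p"
proof -
  let ?S = "(fst p + 1, snd p)" and ?W = "(fst p, snd p + 1)"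
  define U where "U = paths D ?S q \<union> paths D ?W q"
  have finite: "finite (paths D ?S q)" "finite (paths D ?W q)"
    using finite_paths [OF D] by auto
  have disj: "paths D ?S q \<inter> paths D ?W q = {}"
    by (auto simp: paths_def)
  have eq: "paths D p q = Cons p ` U"
  proof (intro subset_antisym subsetI)
    fix \<pi> assume \<pi>: "\<pi> \<in> paths D p q"
    obtain \<pi>' where eq: "\<pi> = p # \<pi>'"
      using \<pi> by (cases \<pi>) (auto simp: paths_def)
    have "\<pi>' \<noteq> []" using \<pi> eq pq by (auto simp: paths_def)
    then have "\<pi>' \<in> U" using \<pi> eq
      by (auto simp: paths_def U_def successively_Cons sw_step_def)
    then show "\<pi> \<in> Cons p ` U" using eq by simp
  next
    fix \<pi> assume "\<pi> \<in> Cons p ` U"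
    then show "\<pi> \<in> paths D p q"
      using p by (auto simp: paths_def U_def successively_Cons sw_step_def)
  qed
  have "path_sum D p q = (\<Sum>\<pi>\<in>U. \<Prod>z\<in>set (p # \<pi>). 1 / cell_factor z)"
    unfolding path_sum_def eq by (subst sum.reindex) (auto simp: inj_on_def)
  also have "\<dots> = (\<Sum>\<pi>\<in>U. (\<Prod>z\<in>set \<pi>. 1 / cell_factor z) / cell_factor p)"
  proof (rule sum.cong)
    fix \<pi> assume "\<pi> \<in> U"
    then have "p # \<pi> \<in> paths D p q" using eq by auto
    then have "p \<notin> set \<pi>" using sw_path_distinct by (fastforce simp: paths_def)
    then show "(\<Prod>z\<in>set (p # \<pi>). 1 / cell_factor z) = (\<Prod>z\<in>set \<pi>. 1 / cell_factor z) / cell_factor p"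
      by simp
  qed simp
  also have "\<dots> = (path_sum D ?S q + path_sum D ?W q) / cell_factor p"
    using disj finite by (simp add: U_def sum.union_disjoint path_sum_def sum_divide_distrib add_divide_distrib)
  finally show ?thesis .
qed

section \<open>Linear extension sums of skew diagrams\<close>

text \<open>Columns are numbered from right to left, so the cells weakly between \<open>(i, j)\<close> and a cell \<open>(i', j')\<close> to
the southeast of it have row index in \<open>{i..i'}\<close> and column index in \<open>{j'..j}\<close>.\<close>

definition order_convex :: "(nat \<times> nat) set \<Rightarrow> bool" where
  "order_convex D \<longleftrightarrow> (\<forall>i j i' j' k l. (i, j) \<in> D \<longrightarrow> (i', j') \<in> D \<longrightarrow>
     i \<le> k \<longrightarrow> k \<le> i' \<longrightarrow> j' \<le> l \<longrightarrow> l \<le> j \<longrightarrow> (k, l) \<in> D)"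

lemma order_convexD:
  assumes "order_convex D" and "(i, j) \<in> D" "(i', j') \<in> D"
    and "i \<le> k" "k \<le> i'" "j' \<le> l" "l \<le> j"
  shows "(k, l) \<in> D"
  using assms(1) [unfolded order_convex_def, rule_format, OF assms(2-)] .

lemma poset_order_iff [simp]:
  "(X i, Y j) \<in> poset_order D \<longleftrightarrow> (i, j) \<in> D"
  "(X i, X i') \<notin> poset_order D" "(Y j, v) \<notin> poset_order D"
  by (auto simp: poset_order_def)

text \<open>Cut with \<open>u = x\<^sub>a\<close> and \<open>v = y\<^sub>b\<close>. As \<open>x\<^sub>a < y\<^sub>b\<close>, an ideal that separates them contains \<open>x\<^sub>a\<close> and not
\<open>y\<^sub>b\<close>. Suppose that it contains more than \<open>x\<^sub>a\<close> and that its complement contains more than \<open>y\<^sub>b\<close>. If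
both pieces contribute, then \<open>x\<^sub>a < y\<^sub>j\<close> inside the ideal and \<open>x\<^sub>i < y\<^sub>b\<close> outside of it for some \<open>i\<close>,
\<open>j\<close>. But \<open>(i, j)\<close> lies between \<open>(a, j)\<close> and \<open>(i, b)\<close>, so \<open>x\<^sub>i < y\<^sub>j\<close>, which contradicts that the set is
an ideal. The exceptional value 1 belongs to the single cell, where the two remaining cuts coincide.\<close>

lemma Psi_corner:
  assumes conv: "order_convex D" and corner: "(a, b) \<in> D"
    and V: "V = X ` I \<union> Y ` J" "finite I" "finite J"
    and a: "a \<in> I" "\<And>i. i \<in> I \<Longrightarrow> a \<le> i" and b: "b \<in> J" "\<And>j. j \<in> J \<Longrightarrow> b \<le> j"
  shows "(rvar (X a) - rvar (Y b)) * Psi V (poset_order D) =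
     (if I = {a} \<and> J = {b} then 1
      else Psi (V - {X a}) (poset_order D) + Psi (V - {Y b}) (poset_order D))"
proof -
  let ?R = "poset_order D"
  define T where "T A = (of_bool (X a \<in> A) - of_bool (Y b \<in> A)) * (Psi A ?R * Psi (V - A) ?R)" for A
  have fin: "finite V" and mem: "X a \<in> V" "Y b \<in> V" using V a b by auto
  have "(rvar (X a) - rvar (Y b)) * Psi V ?R = (\<Sum>A \<in> ideals V ?R - {{}, V}. T A)"
    unfolding T_def using fin mem by (rule Psi_cut)
  also have "\<dots> = (\<Sum>A \<in> {{X a}, V - {Y b}}. T A)"
  proof (rule sum.mono_neutral_right)
    show "finite (ideals V ?R - {{}, V})"
      by (rule finite_subset [of _ "Pow V"]) (use fin in \<open>auto simp: ideals_def\<close>)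
    have min: "(u, X a) \<notin> ?R" for u by (auto simp: poset_order_def)
    have "{X a} \<in> ideals V ?R" using mem min by (simp add: ideals_def)
    moreover have "V - {Y b} \<in> ideals V ?R"
      unfolding ideals_def by auto
    moreover have "{X a} \<noteq> V" using mem(2) by blast
    moreover have "V - {Y b} \<noteq> {}" "V - {Y b} \<noteq> V" using mem by blast+
    ultimately show "{{X a}, V - {Y b}} \<subseteq> ideals V ?R - {{}, V}" by simp
    show "\<forall>A \<in> ideals V ?R - {{}, V} - {{X a}, V - {Y b}}. T A = 0"
    proof (intro ballI)
      fix A assume A: "A \<in> ideals V ?R - {{}, V} - {{X a}, V - {Y b}}"
      then have sub: "A \<subseteq> V" and down: "\<And>u w. u \<in> V \<Longrightarrow> w \<in> A \<Longrightarrow> (u, w) \<in> ?R \<Longrightarrow> u \<in> A"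
        by (auto simp: ideals_def)
      show "T A = 0"
      proof (cases "X a \<in> A \<and> Y b \<notin> A")
        case False
        moreover have "Y b \<in> A \<Longrightarrow> X a \<in> A" using down [OF mem(1)] corner by auto
        ultimately show ?thesis by (auto simp: T_def)
      next
        case True
        have "Psi A ?R = 0 \<or> Psi (V - A) ?R = 0"
        proof (rule ccontr)
          assume neg: "\<not> ?thesis"
          have "\<exists>w\<in>A. (X a, w) \<in> ?R \<or> (w, X a) \<in> ?R"
          proof (rule ccontr)
            assume "\<not> ?thesis"
            moreover have "finite A" "X a \<in> A" "A \<noteq> {X a}"
              using finite_subset [OF sub fin] True A by simp_all
            ultimately have "Psi A ?R = 0"
              by (intro Psi_isolated [of A "X a"]) blast+
            then show False using neg by simp
          qed
          then obtain j where j: "Y j \<in> A" "(a, j) \<in> D"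
            by (auto simp: poset_order_def)
          have "\<exists>w\<in>V - A. (Y b, w) \<in> ?R \<or> (w, Y b) \<in> ?R"
          proof (rule ccontr)
            assume "\<not> ?thesis"
            moreover have "V - A \<noteq> {Y b}"
            proof
              assume "V - A = {Y b}"
              then have "A = V - {Y b}" using sub by blast
              then show False using A by simp
            qed
            ultimately have "Psi (V - A) ?R = 0"
              using True fin mem by (intro Psi_isolated [of "V - A" "Y b"]) blast+
            then show False using neg by simp
          qed
          then obtain i where i: "X i \<in> V" "X i \<notin> A" "(i, b) \<in> D"
            by (auto simp: poset_order_def)
          have "i \<in> I" "j \<in> J" using i(1) j(1) sub V(1) by auto
          then have "(i, j) \<in> D"
            using order_convexD [OF conv j(2) i(3), of i j] a b by auto
          then show False using down [OF i(1) j(1)] i(2) by simp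
        qed
        then show ?thesis by (auto simp: T_def)
      qed
    qed
  qed
  also have "\<dots> = (if I = {a} \<and> J = {b} then 1
      else Psi (V - {X a}) ?R + Psi (V - {Y b}) ?R)"
  proof (cases "I = {a} \<and> J = {b}")
    case True
    then have "V = {X a, Y b}" using V by auto
    then have "V - {X a} = {Y b}" "V - {Y b} = {X a}" by auto
    then show ?thesis using True by (simp add: T_def Psi_singleton)
  next
    case False
    have "{X a} \<noteq> V - {Y b}"
    proof
      assume eq: "{X a} = V - {Y b}"
      have "i = a" if "i \<in> I" for i
      proof -
        have "X i \<in> V - {Y b}" using that V(1) by auto
        then show ?thesis using eq by auto
      qed
      moreover have "j = b" if "j \<in> J" for j
      proof (rule ccontr)
        assume "j \<noteq> b"
        then have "Y j \<in> V - {Y b}" using that V(1) by auto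
        then show False using eq by auto
      qed
      ultimately have "I = {a}" "J = {b}" using a(1) b(1) by blast+
      then show False using False by blast
    qed
    then have "(\<Sum>A \<in> {{X a}, V - {Y b}}. T A) = T {X a} + T (V - {Y b})"
      by simp
    moreover have "V - (V - {Y b}) = {Y b}" using mem by auto
    ultimately show ?thesis using mem
      by (simp only: False if_False) (simp add: T_def Psi_singleton)
  qed
  finally show ?thesis .
qed

text \<open>Both sides satisfy the corner recursion. If the corner of the diagram without its first row is not a
cell, then by convexity \<open>y\<^sub>b\<close> has become isolated, so that \<open>Psi\<close> and the path sum both vanish; the same
holds for \<open>x\<^sub>a\<close> and the first column. This also covers diagrams with empty rows or columns in the middle.\<close>

lemma Psi_eq_path_sum:
  assumes conv: "order_convex D" and D: "D \<subseteq> {..r} \<times> {..c}"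
  shows "(a, b) \<in> D \<Longrightarrow>
     Psi (X ` {a..r} \<union> Y ` {b..c}) (poset_order D) = path_sum D (a, b) (r, c)"
proof (induction "(r - a) + (c - b)" arbitrary: a b rule: less_induct)
  case less
  let ?R = "poset_order D" and ?V = "\<lambda>a b. X ` {a..r} \<union> Y ` {b..c}"
  have fin: "finite D" using D finite_subset by blast
  have ab: "a \<le> r" "b \<le> c" using less.prems D by auto
  have corner: "(rvar (X a) - rvar (Y b)) * Psi (?V a b) ?R =
     (if {a..r} = {a} \<and> {b..c} = {b} then 1
      else Psi (?V a b - {X a}) ?R + Psi (?V a b - {Y b}) ?R)"
    by (rule Psi_corner [OF conv less.prems]) (use ab in auto)
  have nz: "rvar (X a) - rvar (Y b) \<noteq> 0" by simp
  show ?case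
  proof (cases "a = r \<and> b = c")
    case True
    then show ?thesis using corner nz less.prems by (simp add: path_sum_end field_simps)
  next
    case False
    have "\<not> ({a..r} = {a} \<and> {b..c} = {b})"
    proof -
      have "r \<in> {a..r}" "c \<in> {b..c}" using ab by auto
      then show ?thesis using False by (metis singletonD)
    qed
    moreover have "?V a b - {X a} = ?V (a + 1) b"
    proof -
      have "?V a b - {X a} = X ` ({a..r} - {a}) \<union> Y ` {b..c}" by blast
      also have "{a..r} - {a} = {a + 1..r}" by auto
      finally show ?thesis .
    qed
    moreover have "?V a b - {Y b} = ?V a (b + 1)"
    proof -
      have "?V a b - {Y b} = X ` {a..r} \<union> Y ` ({b..c} - {b})" by blast
      also have "{b..c} - {b} = {b + 1..c}" by auto
      finally show ?thesis .
    qed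
    moreover have "Psi (?V (a + 1) b) ?R = path_sum D (a + 1, b) (r, c)"
    proof (cases "(a + 1, b) \<in> D")
      case True
      then have "a + 1 \<le> r" using D by auto
      then show ?thesis using True by (intro less.hyps) auto
    next
      case out: False
      have none: "(i, b) \<notin> D" if "a + 1 \<le> i" for i
        using order_convexD [OF conv less.prems, of i b "a + 1" b] that out by auto
      have "?V (a + 1) b \<noteq> {Y b}"
      proof (cases "a = r")
        case True
        then have "Y c \<in> ?V (a + 1) b" "c \<noteq> b" using ab False by auto
        then show ?thesis by auto
      next
        case False
        then have "X r \<in> ?V (a + 1) b" using ab by auto
        then show ?thesis by auto
      qed
      then have "Psi (?V (a + 1) b) ?R = 0"
      proof (intro Psi_isolated)
        show "Y b \<in> ?V (a + 1) b" using ab by simp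
        fix w assume "w \<in> ?V (a + 1) b"
        then show "(Y b, w) \<notin> ?R \<and> (w, Y b) \<notin> ?R" using none by auto
      qed simp_all
      then show ?thesis using out by (simp add: path_sum_outside)
    qed
    moreover have "Psi (?V a (b + 1)) ?R = path_sum D (a, b + 1) (r, c)"
    proof (cases "(a, b + 1) \<in> D")
      case True
      then have "b + 1 \<le> c" using D by auto
      then show ?thesis using True by (intro less.hyps) auto
    next
      case out: False
      have none: "(a, j) \<notin> D" if "b + 1 \<le> j" for j
        using order_convexD [OF conv _ less.prems, of a j a "b + 1"] that out by auto
      have "?V a (b + 1) \<noteq> {X a}"
      proof (cases "b = c")
        case True
        then have "X r \<in> ?V a (b + 1)" "r \<noteq> a" using ab False by auto
        then show ?thesis by auto
      next
        case False
        then have "Y c \<in> ?V a (b + 1)" using ab by auto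
        then show ?thesis by auto
      qed
      then have "Psi (?V a (b + 1)) ?R = 0"
      proof (intro Psi_isolated)
        show "X a \<in> ?V a (b + 1)" using ab by simp
        fix w assume "w \<in> ?V a (b + 1)"
        then show "(X a, w) \<notin> ?R \<and> (w, X a) \<notin> ?R" using none by (auto simp: poset_order_def)
      qed simp_all
      then show ?thesis using out by (simp add: path_sum_outside)
    qed
    ultimately have "(rvar (X a) - rvar (Y b)) * Psi (?V a b) ?R =
        path_sum D (a + 1, b) (r, c) + path_sum D (a, b + 1) (r, c)"
      using corner by (simp only: if_False)
    then have "Psi (?V a b) ?R =
        (path_sum D (a + 1, b) (r, c) + path_sum D (a, b + 1) (r, c)) / (rvar (X a) - rvar (Y b))"
      using nz by (metis nonzero_mult_div_cancel_left)
    moreover have "(a, b) \<noteq> (r, c)" using False by simp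
    ultimately show ?thesis
      using path_sum_step [OF fin less.prems, of "(r, c)"] by simp
  qed
qed

lemma partition_antimono:
  assumes "is_partition lam" "1 \<le> i" "i \<le> k"
  shows "lam k \<le> lam i"
  using assms(3)
proof (induction k rule: dec_induct)
  case (step n)
  have "\<forall>i\<ge>1. lam (Suc i) \<le> lam i"
    using assms(1) unfolding is_partition_def by (rule conjunct1)
  moreover have "1 \<le> n" using assms(2) step.hyps(1) by (rule order_trans)
  ultimately have "lam (Suc n) \<le> lam n" by blast
  then show ?case using step.IH by (rule order_trans)
qed simp

lemma finite_cells:
  assumes "is_partition lam"
  shows "finite (cells lam mu)"
proof -
  have "\<exists>m. \<forall>i>m. lam i = 0"
    using assms unfolding is_partition_def by (rule conjunct2)
  then obtain m where m: "\<forall>i>m. lam i = 0" ..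
  have "i \<le> m \<and> k \<le> lam 1" if "(i, k) \<in> cells lam mu" for i k
  proof -
    have ik: "1 \<le> i" "mu i < k" "k \<le> lam i" using that by (auto simp: cells_def)
    then have "i \<le> m" using m by (metis leI not_less_zero order_less_le_trans)
    moreover have "lam i \<le> lam 1" using partition_antimono [OF assms, of 1 i] ik by simp
    ultimately show ?thesis using ik by simp
  qed
  then have "cells lam mu \<subseteq> {..m} \<times> {..lam 1}" by auto
  then show ?thesis by (rule finite_subset) auto
qed

lemma cells_bounds:
  assumes "is_partition lam" and "(i, k) \<in> cells lam mu"
  shows "top_row lam mu \<le> i" "i \<le> Max (fst ` cells lam mu)"
    "Min (snd ` cells lam mu) \<le> k" "k \<le> right_col lam mu"
proof -
  have "i \<in> fst ` cells lam mu" "k \<in> snd ` cells lam mu"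
    using imageI [OF assms(2), of fst] imageI [OF assms(2), of snd] by simp_all
  moreover have "finite (fst ` cells lam mu)" "finite (snd ` cells lam mu)"
    using finite_cells [OF assms(1)] by auto
  ultimately show "top_row lam mu \<le> i" "i \<le> Max (fst ` cells lam mu)"
    "Min (snd ` cells lam mu) \<le> k" "k \<le> right_col lam mu"
    unfolding top_row_def right_col_def by simp_all
qed

lemma skew_diagram_iff:
  assumes "is_partition lam"
  shows "(i, j) \<in> skew_diagram lam mu \<longleftrightarrow> 1 \<le> i \<and> 1 \<le> j \<and> j \<le> right_col lam mu \<and>
     (i + top_row lam mu - 1, right_col lam mu + 1 - j) \<in> cells lam mu"
    (is "?l \<longleftrightarrow> ?r")
proof
  assume ?l
  then obtain i' k where ik: "(i', k) \<in> cells lam mu"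
    "i = i' + 1 - top_row lam mu" "j = right_col lam mu + 1 - k"
    by (auto simp: skew_diagram_def)
  have "top_row lam mu \<le> i'" "k \<le> right_col lam mu"
    using cells_bounds [OF assms ik(1)] by simp_all
  moreover have "1 \<le> k" using ik(1) by (auto simp: cells_def)
  ultimately show ?r using ik by auto
next
  assume r: ?r
  then show ?l
    unfolding skew_diagram_def
    by (intro image_eqI [of _ _ "(i + top_row lam mu - 1, right_col lam mu + 1 - j)"]) auto
qed

lemma order_convex_skew_diagram:
  assumes lam: "is_partition lam" and mu: "is_partition mu"
  shows "order_convex (skew_diagram lam mu)"
  unfolding order_convex_def
proof (intro allI impI)
  fix i j i' j' k l
  assume "(i, j) \<in> skew_diagram lam mu" "(i', j') \<in> skew_diagram lam mu"
    and le: "i \<le> k" "k \<le> i'" "j' \<le> l" "l \<le> j"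
  then have ij: "1 \<le> i" "j \<le> right_col lam mu" "1 \<le> j'"
     "(i + top_row lam mu - 1, right_col lam mu + 1 - j) \<in> cells lam mu"
    and ij': "(i' + top_row lam mu - 1, right_col lam mu + 1 - j') \<in> cells lam mu"
    by (auto simp: skew_diagram_iff [OF lam])
  have "mu (k + top_row lam mu - 1) \<le> mu (i + top_row lam mu - 1)"
    using ij le by (intro partition_antimono [OF mu]) (auto simp: cells_def)
  moreover have "lam (i' + top_row lam mu - 1) \<le> lam (k + top_row lam mu - 1)"
    using ij le by (intro partition_antimono [OF lam]) (auto simp: cells_def)
  moreover have "right_col lam mu + 1 - j \<le> right_col lam mu + 1 - l"
    "right_col lam mu + 1 - l \<le> right_col lam mu + 1 - j'"
    using le by auto
  moreover have "1 \<le> k + top_row lam mu - 1" using ij le by (auto simp: cells_def)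
  ultimately have "(k + top_row lam mu - 1, right_col lam mu + 1 - l) \<in> cells lam mu"
    using ij(4) ij' unfolding cells_def mem_Collect_eq prod.case by linarith
  then show "(k, l) \<in> skew_diagram lam mu"
    using ij le by (auto simp: skew_diagram_iff [OF lam])
qed

text \<open>The topmost occupied row is the longest of the occupied ones, so it reaches the rightmost occupied
column.\<close>

lemma skew_diagram_corner:
  assumes lam: "is_partition lam" and mu: "is_partition mu" and ne: "skew_diagram lam mu \<noteq> {}"
  shows "(1, 1) \<in> skew_diagram lam mu"
proof -
  have fin: "finite (cells lam mu)" and ne: "cells lam mu \<noteq> {}"
    using finite_cells [OF lam] ne by (auto simp: skew_diagram_def)
  have "top_row lam mu \<in> fst ` cells lam mu" "right_col lam mu \<in> snd ` cells lam mu"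
    unfolding top_row_def right_col_def using fin ne by (auto intro!: Min_in Max_in)
  then obtain i k where i: "(i, right_col lam mu) \<in> cells lam mu"
    and k: "(top_row lam mu, k) \<in> cells lam mu" by auto
  have "top_row lam mu \<le> i" "k \<le> right_col lam mu"
    using cells_bounds [OF lam i] cells_bounds [OF lam k] by simp_all
  moreover have "lam i \<le> lam (top_row lam mu)"
    using k \<open>top_row lam mu \<le> i\<close> by (intro partition_antimono [OF lam]) (auto simp: cells_def)
  ultimately have "(top_row lam mu, right_col lam mu) \<in> cells lam mu"
    using i k by (auto simp: cells_def)
  moreover from this have "1 \<le> right_col lam mu" by (auto simp: cells_def)
  ultimately show ?thesis by (simp add: skew_diagram_iff [OF lam])
qed

lemma skew_diagram_bounds:
  assumes lam: "is_partition lam"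
  shows "skew_diagram lam mu \<subseteq> {1..num_rows lam mu} \<times> {1..num_cols lam mu}"
proof (rule subrelI)
  fix i j assume ij: "(i, j) \<in> skew_diagram lam mu"
  let ?p = "(i + top_row lam mu - 1, right_col lam mu + 1 - j)"
  have p: "?p \<in> cells lam mu" and 1: "1 \<le> i" "1 \<le> j" "j \<le> right_col lam mu"
    using ij by (auto simp: skew_diagram_iff [OF lam])
  have "fst ?p \<le> Max (fst ` cells lam mu)" "Min (snd ` cells lam mu) \<le> snd ?p"
    using cells_bounds [OF lam p] by simp_all
  then show "(i, j) \<in> {1..num_rows lam mu} \<times> {1..num_cols lam mu}"
    using 1 by (auto simp: num_rows_def num_cols_def)
qed

theorem Psi_skew_diagram:
  assumes lam: "is_partition lam" and mu: "is_partition mu"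
    and D: "D = skew_diagram lam mu" "D \<noteq> {}"
    and r: "r = num_rows lam mu" and c: "c = num_cols lam mu"
  shows "Psi (poset_elements r c) (poset_order D) = path_sum D (1, 1) (r, c)"
proof -
  have "D \<subseteq> {..r} \<times> {..c}"
    using skew_diagram_bounds [OF lam, of mu] D r c by auto
  then show ?thesis
    using Psi_eq_path_sum [of D r c 1 1] order_convex_skew_diagram [OF lam mu]
      skew_diagram_corner [OF lam mu] D by (simp add: poset_elements_def)
qed

text \<open>Bringing the reciprocals to the common denominator \<open>\<Prod> (x\<^sub>i - y\<^sub>j)\<close> over the whole diagram turns the
cells visited by a path into the cells avoided by it.\<close>

lemma path_sum_complement:
  assumes "finite D"
  shows "path_sum D (1, 1) (r, c) =
     (\<Sum>p \<in> lattice_paths D r c. \<Prod>(i, j) \<in> D - set p. rvar (X i) - rvar (Y j))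
           / (\<Prod>(i, j) \<in> D. rvar (X i) - rvar (Y j))"
proof -
  have "(\<Prod>z\<in>set p. 1 / cell_factor z) =
      (\<Prod>z\<in>D - set p. cell_factor z) / (\<Prod>z\<in>D. cell_factor z)" if "set p \<subseteq> D" for p
  proof -
    have "(\<Prod>z\<in>D. cell_factor z) = (\<Prod>z\<in>D - set p. cell_factor z) * (\<Prod>z\<in>set p. cell_factor z)"
      using assms that by (rule prod.subset_diff [rotated])
    moreover have "(\<Prod>z\<in>D - set p. cell_factor z) \<noteq> 0" using assms by auto
    ultimately show ?thesis by (simp add: prod_dividef)
  qed
  then have "path_sum D (1, 1) (r, c) =
      (\<Sum>p\<in>paths D (1, 1) (r, c). (\<Prod>z\<in>D - set p. cell_factor z) / (\<Prod>z\<in>D. cell_factor z))"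
    by (simp add: path_sum_def paths_def)
  moreover have "lattice_paths D r c = paths D (1, 1) (r, c)"
    by (simp add: lattice_paths_def paths_def)
  ultimately show ?thesis
    by (simp add: sum_divide_distrib split_def)
qed


section \<open>Divided differences\<close>

lemma poly_mapping_induct_single_add:
  fixes f :: "'a \<Rightarrow>\<^sub>0 'b::comm_monoid_add"
  assumes "P 0" and add: "\<And>a b f. P f \<Longrightarrow> P (Poly_Mapping.single a b + f)"
  shows "P f"
proof (induction f rule: update_induct)
  case (update f a b)
  have "Poly_Mapping.update a b f = Poly_Mapping.single a b + f"
    using update.hyps(1)
    by (intro poly_mapping_eqI) (auto simp: lookup_update lookup_add lookup_single in_keys_iff)
  then show ?case using add [OF update.IH] by simp
qed (fact assms(1))

text \<open>A polynomial is built from constants and variables by ring operations, so this rule proves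
identities between ring homomorphisms and closure properties that respect sums and products.\<close>

lemma mpoly_induct [case_names const var add mult]:
  fixes f :: mpoly
  assumes const: "\<And>c. P (Poly_Mapping.single 0 c)" and var: "\<And>v. P (pvar v)"
    and add: "\<And>f g. P f \<Longrightarrow> P g \<Longrightarrow> P (f + g)" and mult: "\<And>f g. P f \<Longrightarrow> P g \<Longrightarrow> P (f * g)"
  shows "P f"
proof -
  have one: "P 1" using const [of 1] by simp
  have power: "P (Poly_Mapping.single (Poly_Mapping.single v k) 1)" for v k
  proof (induction k)
    case 0
    then show ?case using one by simp
  next
    case (Suc k)
    have "Poly_Mapping.single (Poly_Mapping.single v (Suc k)) 1 =
        pvar v * Poly_Mapping.single (Poly_Mapping.single v k) (1::rat)"
      by (simp add: pvar_def mult_single flip: single_add)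
    then show ?case using mult [OF var Suc.IH] by simp
  qed
  have monomial: "P (Poly_Mapping.single m c)" for m c
  proof (induction m rule: poly_mapping_induct_single_add)
    case (2 v k m)
    have "Poly_Mapping.single (Poly_Mapping.single v k + m) c =
        Poly_Mapping.single (Poly_Mapping.single v k) 1 * Poly_Mapping.single m c"
      by (simp add: mult_single)
    then show ?case using mult [OF power 2] by simp
  qed (fact const)
  show ?thesis
  proof (induction f rule: poly_mapping_induct_single_add)
    case 1
    then show ?case using const [of 0] by simp
  next
    case (2 m c f)
    then show ?case using add monomial by blast
  qed
qed

text \<open>Precomposition with an involution is an involution on exponent functions. This is why the substitution
acts on monomials in the expected direction.\<close>

lemma map_key_invol:
  fixes m :: "'a \<Rightarrow>\<^sub>0 nat"
  assumes "\<And>v. \<sigma> (\<sigma> v) = v"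
  shows "Poly_Mapping.map_key \<sigma> (Poly_Mapping.map_key \<sigma> m) = m"
proof -
  have inj: "inj \<sigma>" using assms by (metis injI)
  show ?thesis using assms by (simp add: map_key_compose [OF inj inj] o_def map_key_id)
qed

lemma inj_map_key:
  assumes "\<And>v. \<sigma> (\<sigma> v) = v"
  shows "inj (Poly_Mapping.map_key \<sigma> :: ('a \<Rightarrow>\<^sub>0 nat) \<Rightarrow> _)"
  using map_key_invol [OF assms] by (metis injI)

lemma subst_invol_add:
  assumes "\<And>v. \<sigma> (\<sigma> v) = v"
  shows "subst_invol \<sigma> (f + g) = subst_invol \<sigma> f + subst_invol \<sigma> g"
  unfolding subst_invol_def using inj_map_key [OF assms] by (rule map_key_plus)

lemma subst_invol_0: "(\<And>v. \<sigma> (\<sigma> v) = v) \<Longrightarrow> subst_invol \<sigma> 0 = 0"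
  unfolding subst_invol_def by (rule map_key_zero [OF inj_map_key])

lemma subst_invol_single:
  assumes "\<And>v. \<sigma> (\<sigma> v) = v"
  shows "subst_invol \<sigma> (Poly_Mapping.single m c) =
    Poly_Mapping.single (Poly_Mapping.map_key \<sigma> m) c"
  using map_key_single [OF inj_map_key [OF assms], of "Poly_Mapping.map_key \<sigma> m" c]
  by (simp add: subst_invol_def map_key_invol [OF assms])

lemma subst_invol_mult:
  assumes invol: "\<And>v. \<sigma> (\<sigma> v) = v"
  shows "subst_invol \<sigma> (f * g) = subst_invol \<sigma> f * subst_invol \<sigma> g"
proof -
  have inj: "inj \<sigma>" using invol by (metis injI)
  note simps = subst_invol_add [of \<sigma>, OF invol] subst_invol_0 [of \<sigma>, OF invol] subst_invol_single [of \<sigma>, OF invol]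
  have mono: "subst_invol \<sigma> (Poly_Mapping.single m c * g) =
      subst_invol \<sigma> (Poly_Mapping.single m c) * subst_invol \<sigma> g" for m c
    by (induction g rule: poly_mapping_induct_single_add)
       (simp_all add: simps distrib_left mult_single map_key_plus [OF inj])
  show ?thesis
    by (induction f rule: poly_mapping_induct_single_add)
       (simp_all add: simps distrib_right mono)
qed

lemma subst_invol_const:
  assumes "\<And>v. \<sigma> (\<sigma> v) = v"
  shows "subst_invol \<sigma> (Poly_Mapping.single 0 c) = Poly_Mapping.single 0 c"
proof -
  have "inj \<sigma>" using assms by (metis injI)
  then show ?thesis by (simp add: subst_invol_single [OF assms])
qed

lemma subst_invol_pvar:
  assumes "\<And>v. \<sigma> (\<sigma> v) = v"
  shows "subst_invol \<sigma> (pvar v) = pvar (\<sigma> v)"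
proof -
  have "inj \<sigma>" using assms by (metis injI)
  then have "Poly_Mapping.map_key \<sigma> (Poly_Mapping.single (\<sigma> (\<sigma> v)) (1::nat)) = Poly_Mapping.single (\<sigma> v) 1"
    by (rule map_key_single)
  then show ?thesis by (simp add: pvar_def subst_invol_single [OF assms] assms)
qed

lemma subst_invol_diff:
  assumes "\<And>v. \<sigma> (\<sigma> v) = v"
  shows "subst_invol \<sigma> (f - g) = subst_invol \<sigma> f - subst_invol \<sigma> g"
  using subst_invol_add [OF assms, of "f - g" g] by (simp add: algebra_simps)

lemma subst_invol_sum:
  assumes "\<And>v. \<sigma> (\<sigma> v) = v"
  shows "subst_invol \<sigma> (sum f A) = (\<Sum>x\<in>A. subst_invol \<sigma> (f x))"
  by (induction A rule: infinite_finite_induct)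
     (simp_all add: subst_invol_0 [OF assms] subst_invol_add [OF assms])

lemma subst_invol_prod:
  assumes "\<And>v. \<sigma> (\<sigma> v) = v"
  shows "subst_invol \<sigma> (prod f A) = (\<Prod>x\<in>A. subst_invol \<sigma> (f x))"
proof -
  have "subst_invol \<sigma> 1 = 1" using subst_invol_const [OF assms, of 1] by simp
  then show ?thesis
    by (induction A rule: infinite_finite_induct) (simp_all add: subst_invol_mult [OF assms])
qed

definition swap_vars :: "nat \<Rightarrow> mpoly \<Rightarrow> mpoly" where
  "swap_vars i = subst_invol (transpose (X i) (X (Suc i)))"

lemma swap_vars_simps:
  "swap_vars i (f + g) = swap_vars i f + swap_vars i g"
  "swap_vars i (f - g) = swap_vars i f - swap_vars i g"
  "swap_vars i (f * g) = swap_vars i f * swap_vars i g"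
  "swap_vars i (sum h A) = (\<Sum>x\<in>A. swap_vars i (h x))"
  "swap_vars i (prod h A) = (\<Prod>x\<in>A. swap_vars i (h x))"
  "swap_vars i (Poly_Mapping.single 0 c) = Poly_Mapping.single 0 c"
  "swap_vars i (pvar v) = pvar (transpose (X i) (X (Suc i)) v)"
  by (simp_all add: swap_vars_def subst_invol_add subst_invol_diff subst_invol_mult
      subst_invol_sum subst_invol_prod subst_invol_const subst_invol_pvar)

lemma swap_vars_1 [simp]: "swap_vars i 1 = 1"
  using swap_vars_simps(6) [of i 1] by simp

lemma swap_vars_pvar_X:
  "swap_vars i (pvar (X i)) = pvar (X (Suc i))"
  "swap_vars i (pvar (X (Suc i))) = pvar (X i)"
  "k \<noteq> i \<Longrightarrow> k \<noteq> Suc i \<Longrightarrow> swap_vars i (pvar (X k)) = pvar (X k)"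
  "swap_vars i (pvar (Y j)) = pvar (Y j)"
  by (simp_all add: swap_vars_simps transpose_def)

lemma swap_vars_invol [simp]: "swap_vars i (swap_vars i f) = f"
  by (induction f rule: mpoly_induct) (simp_all add: swap_vars_simps)

lemma swap_vars_braid:
  "swap_vars i (swap_vars (Suc i) (swap_vars i f)) =
   swap_vars (Suc i) (swap_vars i (swap_vars (Suc i) f))"
  by (induction f rule: mpoly_induct) (simp_all add: swap_vars_simps, simp add: transpose_def)

lemma swap_vars_commute:
  assumes "Suc i < j"
  shows "swap_vars i (swap_vars j f) = swap_vars j (swap_vars i f)"
  by (induction f rule: mpoly_induct)
     (use assms in \<open>simp_all add: swap_vars_simps\<close>, simp add: transpose_def)

text \<open>The quotient exists for constants and variables, and existence is inherited by sums and, through the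
twisted Leibniz rule \<open>\<partial>(f g) = \<partial>f * g + s f * \<partial>g\<close>, by products.\<close>

lemma divided_difference_spec:
  "(pvar (X i) - pvar (X (Suc i))) * divided_difference i f = f - swap_vars i f"
proof -
  let ?a = "pvar (X i) - pvar (X (Suc i))"
  have "\<exists>g. ?a * g = f - swap_vars i f"
  proof (induction f rule: mpoly_induct)
    case (const c)
    then show ?case by (intro exI [of _ 0]) (simp add: swap_vars_simps)
  next
    case (var v)
    consider "v = X i" | "v = X (Suc i)" | "v \<noteq> X i" "v \<noteq> X (Suc i)" by blast
    then show ?case
    proof cases
      case 1
      then show ?thesis by (intro exI [of _ 1]) (simp add: swap_vars_pvar_X)
    next
      case 2
      then show ?thesis by (intro exI [of _ "- 1"]) (simp add: swap_vars_pvar_X)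
    next
      case 3
      then show ?thesis by (intro exI [of _ 0]) (simp add: swap_vars_simps)
    qed
  next
    case (add f g)
    then obtain f' g' where "?a * f' = f - swap_vars i f" "?a * g' = g - swap_vars i g" by blast
    then show ?case
      by (intro exI [of _ "f' + g'"]) (simp add: swap_vars_simps distrib_left)
  next
    case (mult f g)
    then obtain f' g' where f': "?a * f' = f - swap_vars i f" and g': "?a * g' = g - swap_vars i g"
      by blast
    have "?a * (f' * g + swap_vars i f * g') = (?a * f') * g + swap_vars i f * (?a * g')"
      by (simp add: algebra_simps)
    also have "\<dots> = f * g - swap_vars i (f * g)"
      unfolding f' g' by (simp add: swap_vars_simps algebra_simps)
    finally show ?case by blast
  qed
  then obtain g where g: "?a * g = f - swap_vars i f" by blast
  have "?a \<noteq> 0" by simp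
  then have "divided_difference i f = g"
    unfolding divided_difference_def swap_vars_def [symmetric]
    using g by (intro the_equality) (auto simp flip: g)
  then show ?thesis using g by simp
qed

lemma divided_difference_eqI:
  assumes "(pvar (X i) - pvar (X (Suc i))) * g = f - swap_vars i f"
  shows "divided_difference i f = g"
proof -
  have "(pvar (X i) - pvar (X (Suc i))) * divided_difference i f = (pvar (X i) - pvar (X (Suc i))) * g"
    by (simp add: assms divided_difference_spec)
  then show ?thesis by simp
qed

lemma divided_difference_sum:
  "divided_difference i (sum f A) = (\<Sum>x\<in>A. divided_difference i (f x))"
  by (rule divided_difference_eqI)
     (simp add: sum_distrib_left divided_difference_spec swap_vars_simps sum_subtractf)

lemma divided_difference_mult_symmetric:
  "swap_vars i g = g \<Longrightarrow> divided_difference i (g * f) = g * divided_difference i f"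
  by (rule divided_difference_eqI)
     (simp add: divided_difference_spec swap_vars_simps right_diff_distrib mult.left_commute)

text \<open>Clearing denominators in \<open>\<partial>\<^sub>s \<partial>\<^sub>t \<partial>\<^sub>s f\<close> gives the alternating sum of \<open>f\<close> over the six permutations of
three variables. Here \<open>s\<close> and \<open>t\<close> are the two adjacent transpositions, and \<open>a\<close>, \<open>b\<close>, \<open>a + b\<close> are the
three differences of variables. Apart from the last terms \<open>s t s f\<close> and \<open>t s t f\<close>, which agree, the
right-hand side is symmetric in \<open>s\<close> and \<open>t\<close>; this is the source of the braid relation.\<close>

lemma antisymmetrizer_of_iterated_differences:
  fixes s t :: "'a::comm_ring_1 \<Rightarrow> 'a"
  assumes s: "\<And>p q. s (p - q) = s p - s q" "\<And>p q. s (p * q) = s p * s q"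
    and t: "\<And>p q. t (p - q) = t p - t q" "\<And>p q. t (p * q) = t p * t q"
    and ss: "s (s f) = f"
    and sa: "s a = - a" and sb: "s b = a + b" and sab: "s (a + b) = b" and ta: "t a = a + b"
    and f1: "a * f1 = f - s f" and f2: "b * f2 = f1 - t f1" and f3: "a * f3 = f2 - s f2"
    and cancel: "\<And>p q. a * p = a * q \<Longrightarrow> p = q"
  shows "a * b * (a + b) * f3 = f - s f - t f + s (t f) + t (s f) - s (t (s f))"
proof -
  \<comment> \<open>A divided difference is symmetric in the two variables concerned.\<close>
  have sf1: "s f1 = f1"
  proof (rule cancel)
    have "s (a * f1) = s f - f" unfolding f1 by (simp add: s ss)
    then have "- (a * s f1) = s f - f" by (simp add: s sa)
    then show "a * s f1 = a * f1" unfolding f1 by (simp add: algebra_simps)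
  qed
  have tf1: "(a + b) * t f1 = t f - t (s f)"
    using arg_cong [OF f1, of t] by (simp add: t ta)
  have sf2: "(a + b) * s f2 = f1 - s (t f1)"
    using arg_cong [OF f2, of s] by (simp add: s sb sf1)
  have stf1: "b * s (t f1) = s (t f) - s (t (s f))"
    using arg_cong [OF tf1, of s] by (simp only: s sab)
  have "a * b * (a + b) * f3 = (a + b) * b * (a * f3)"
    by (simp add: mult_ac)
  also have "\<dots> = (a + b) * (b * f2) - b * ((a + b) * s f2)"
    unfolding f3 by (simp add: algebra_simps)
  also have "\<dots> = a * f1 - (a + b) * t f1 + b * s (t f1)"
    unfolding f2 sf2 by (simp add: algebra_simps)
  also have "\<dots> = f - s f - t f + s (t f) + t (s f) - s (t (s f))"
    unfolding f1 tf1 stf1 by (simp add: algebra_simps)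
  finally show ?thesis .
qed

lemma divided_difference_braid:
  "divided_difference i (divided_difference (Suc i) (divided_difference i f)) =
   divided_difference (Suc i) (divided_difference i (divided_difference (Suc i) f))"
proof -
  let ?a = "pvar (X i) - pvar (X (Suc i))" and ?b = "pvar (X (Suc i)) - pvar (X (Suc (Suc i)))"
  let ?s = "swap_vars i" and ?t = "swap_vars (Suc i)"
  let ?l = "divided_difference i (divided_difference (Suc i) (divided_difference i f))"
  let ?r = "divided_difference (Suc i) (divided_difference i (divided_difference (Suc i) f))"
  have "?s (pvar (X (Suc (Suc i)))) = pvar (X (Suc (Suc i)))" "?t (pvar (X i)) = pvar (X i)"
    by (simp_all add: swap_vars_pvar_X(3))
  then have act: "?s ?a = - ?a" "?s ?b = ?a + ?b" "?t ?a = ?a + ?b" "?t ?b = - ?b"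
    by (simp_all only: swap_vars_simps(2) swap_vars_pvar_X(1,2) minus_diff_eq diff_add_cancel
        add_diff_eq)
  have actsum: "?s (?a + ?b) = ?b" "?t (?b + ?a) = ?a"
    by (simp_all only: swap_vars_simps(1) act) simp_all
  have "?a * ?b * (?a + ?b) * ?l =
      f - ?s f - ?t f + ?s (?t f) + ?t (?s f) - ?s (?t (?s f))"
    by (rule antisymmetrizer_of_iterated_differences [OF swap_vars_simps(2,3) swap_vars_simps(2,3)
          swap_vars_invol act(1,2) actsum(1) act(3) divided_difference_spec
          divided_difference_spec divided_difference_spec]) simp
  moreover have "?b * ?a * (?b + ?a) * ?r =
      f - ?t f - ?s f + ?t (?s f) + ?s (?t f) - ?t (?s (?t f))"
    by (rule antisymmetrizer_of_iterated_differences [OF swap_vars_simps(2,3) swap_vars_simps(2,3)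
          swap_vars_invol act(4) _ actsum(2) _ divided_difference_spec
          divided_difference_spec divided_difference_spec])
       (simp_all only: act(2,3) add.commute [of ?b ?a], simp)
  moreover have "f - ?t f - ?s f + ?t (?s f) + ?s (?t f) - ?t (?s (?t f)) =
      f - ?s f - ?t f + ?s (?t f) + ?t (?s f) - ?s (?t (?s f))"
    by (simp add: swap_vars_braid algebra_simps)
  moreover have "?b * ?a * (?b + ?a) = ?a * ?b * (?a + ?b)"
    by (simp add: algebra_simps)
  ultimately have "?a * ?b * (?a + ?b) * ?l = ?a * ?b * (?a + ?b) * ?r"
    by metis
  moreover have "?a * ?b * (?a + ?b) \<noteq> 0"
    by simp
  ultimately show ?thesis by (meson mult_cancel_left)
qed

lemma divided_difference_commute:
  assumes "Suc i < j"
  shows "divided_difference i (divided_difference j f) = divided_difference j (divided_difference i f)"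
proof -
  let ?a = "pvar (X i) - pvar (X (Suc i))" and ?b = "pvar (X j) - pvar (X (Suc j))"
  have a: "swap_vars j ?a = ?a" and b: "swap_vars i ?b = ?b"
    using assms by (simp_all add: swap_vars_simps(2) swap_vars_pvar_X)
  have ji: "?b * swap_vars i (divided_difference j f) = swap_vars i f - swap_vars i (swap_vars j f)"
    using arg_cong [OF divided_difference_spec [of j f], of "swap_vars i"]
    by (simp only: swap_vars_simps(2) [where i = i and f = f] swap_vars_simps(3) b)
  have ij: "?a * swap_vars j (divided_difference i f) = swap_vars j f - swap_vars j (swap_vars i f)"
    using arg_cong [OF divided_difference_spec [of i f], of "swap_vars j"]
    by (simp only: swap_vars_simps(2) [where i = j and f = f] swap_vars_simps(3) a)
  have "?a * ?b * divided_difference i (divided_difference j f) =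
      ?b * (divided_difference j f - swap_vars i (divided_difference j f))"
    by (simp only: divided_difference_spec [symmetric, where i = i]) (simp add: mult_ac)
  also have "\<dots> = f - swap_vars j f - (swap_vars i f - swap_vars i (swap_vars j f))"
    unfolding right_diff_distrib [of ?b] divided_difference_spec ji ..
  also have "\<dots> = f - swap_vars i f - (swap_vars j f - swap_vars j (swap_vars i f))"
    by (simp add: swap_vars_commute [OF assms])
  also have "\<dots> = ?a * (divided_difference i f - swap_vars j (divided_difference i f))"
    unfolding right_diff_distrib [of ?a] divided_difference_spec ij ..
  also have "\<dots> = ?a * ?b * divided_difference j (divided_difference i f)"
    by (simp only: divided_difference_spec [symmetric, where i = j]) (simp add: mult_ac)
  finally have "?a * ?b * divided_difference i (divided_difference j f) =
      ?a * ?b * divided_difference j (divided_difference i f)" .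
  moreover have "?a * ?b \<noteq> 0" by simp
  ultimately show ?thesis by (meson mult_cancel_left)
qed


section \<open>Lehmer codes\<close>

lemma is_perm_bij: "is_perm w \<Longrightarrow> bij w"
  by (auto simp: is_perm_def permutes_bij)

lemma is_perm_0: "is_perm w \<Longrightarrow> w 0 = 0"
  by (auto simp: is_perm_def permutes_def)

lemma finite_lehmer_set: "is_perm w \<Longrightarrow> finite {j. i < j \<and> w j < (m::nat)}"
proof -
  assume "is_perm w"
  then have "inj w" using is_perm_bij bij_is_inj by blast
  then have "finite (w -` {..<m})" by (intro finite_vimageI) auto
  then show ?thesis by (rule rev_finite_subset) auto
qed

text \<open>Read by values instead of positions: \<open>w i\<close> has exactly \<open>lehmer_code w i\<close> smaller values that are not yet
used before position \<open>i\<close>. So the code determines \<open>w\<close> from left to right.\<close>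

lemma lehmer_code_values:
  assumes "bij w"
  shows "lehmer_code w i = card ({..<w i} - w ` {..<i})"
proof -
  have inj: "inj w" and surj: "surj w" using assms by (auto simp: bij_def)
  have "w ` {j. i < j \<and> w j < w i} = {..<w i} - w ` {..<i}"
  proof (intro subset_antisym subsetI)
    fix v assume "v \<in> w ` {j. i < j \<and> w j < w i}"
    then show "v \<in> {..<w i} - w ` {..<i}" by (auto simp: inj_eq [OF inj])
  next
    fix v assume v: "v \<in> {..<w i} - w ` {..<i}"
    obtain j where "v = w j" using surj by (meson surjD)
    moreover have "\<not> j < i" using v calculation by auto
    moreover have "j \<noteq> i" using v calculation(1) by auto
    ultimately show "v \<in> w ` {j. i < j \<and> w j < w i}" using v by auto
  qed
  moreover have "card (w ` {j. i < j \<and> w j < w i}) = card {j. i < j \<and> w j < w i}"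
    using inj by (intro card_image) (auto intro: inj_on_subset)
  ultimately show ?thesis by (simp add: lehmer_code_def)
qed

lemma has_code_unique:
  assumes "has_code w c" "has_code w' c"
  shows "w = w'"
proof
  have perm: "is_perm w" "is_perm w'" and code: "\<And>i. 1 \<le> i \<Longrightarrow> lehmer_code w i = lehmer_code w' i"
    using assms by (simp_all add: has_code_def)
  note bij = perm [THEN is_perm_bij]
  fix i show "w i = w' i"
  proof (induction i rule: less_induct)
    case (less i)
    show ?case
    proof (cases "i = 0")
      case True
      then show ?thesis using perm [THEN is_perm_0] by simp
    next
      case False
      define W where "W = w ` {..<i}"
      have W': "w' ` {..<i} = W" unfolding W_def using less by (intro image_cong) auto
      have eq: "card ({..<w i} - W) = card ({..<w' i} - W)"
        using code [of i] lehmer_code_values [OF bij(1), of i] lehmer_code_values [OF bij(2), of i]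
          False by (simp add: W' W_def [symmetric])
      have "w i \<notin> w ` {..<i}" "w' i \<notin> w' ` {..<i}"
        by (simp_all add: inj_image_mem_iff [OF bij_is_inj] bij)
      then have notin: "w i \<notin> W" "w' i \<notin> W"
        unfolding W' by (simp_all add: W_def)
      have "\<not> a < b" if "card ({..<a} - W) = card ({..<b} - W)" "a \<notin> W" for a b :: nat
      proof
        assume "a < b"
        then have "{..<a} - W \<subset> {..<b} - W" using that(2) by auto
        then have "card ({..<a} - W) < card ({..<b} - W)" by (intro psubset_card_mono) auto
        then show False using that(1) by simp
      qed
      then show ?thesis using eq notin by (metis linorder_neqE_nat)
    qed
  qed
qed

lemma has_code_cong: "has_code w c \<Longrightarrow> (\<And>i. 1 \<le> i \<Longrightarrow> c' i = c i) \<Longrightarrow> has_code w c'"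
  by (simp add: has_code_def)

lemma code_ascent:
  assumes w: "is_perm w" and "w i < w (Suc i)"
  shows "lehmer_code w i \<le> lehmer_code w (Suc i)"
  unfolding lehmer_code_def
proof (rule card_mono [OF finite_lehmer_set [OF w]], rule subsetI)
  fix j assume j: "j \<in> {j. i < j \<and> w j < w i}"
  then have "j \<noteq> Suc i" using assms(2) by auto
  then show "j \<in> {j. Suc i < j \<and> w j < w (Suc i)}" using j assms(2) by auto
qed

lemma code_descent:
  assumes "has_code w c" "1 \<le> i" "c (Suc i) < c i"
  shows "w (Suc i) < w i"
proof -
  have w: "is_perm w" and "lehmer_code w (Suc i) < lehmer_code w i"
    using assms by (simp_all add: has_code_def)
  then have "\<not> w i < w (Suc i)" using code_ascent [OF w] by (meson not_le)
  moreover have "w i \<noteq> w (Suc i)"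
    by (simp add: inj_eq [OF bij_is_inj [OF is_perm_bij [OF w]]])
  ultimately show ?thesis by simp
qed

text \<open>Composing with \<open>s\<^sub>i\<close> at a descent exchanges the two code entries and decreases the larger one by one,
because the pair of positions \<open>i\<close>, \<open>i + 1\<close> stops being an inversion.\<close>

lemma has_code_swap:
  assumes w: "has_code w c" and i: "1 \<le> i" and desc: "w (Suc i) < w i"
    and c': "\<And>k. 1 \<le> k \<Longrightarrow> c' k = (c(i := c (Suc i), Suc i := c i - 1)) k"
  shows "has_code (w \<circ> transpose i (Suc i)) c'"
proof -
  let ?s = "transpose i (Suc i)"
  let ?w = "w \<circ> ?s"
  have perm: "is_perm w" and c: "\<And>k. 1 \<le> k \<Longrightarrow> lehmer_code w k = c k"
    using w by (simp_all add: has_code_def)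
  have vals: "?w i = w (Suc i)" "?w (Suc i) = w i" "\<And>k. k \<noteq> i \<Longrightarrow> k \<noteq> Suc i \<Longrightarrow> ?w k = w k"
    by (simp_all add: transpose_def)
  obtain n where n: "w permutes {1..n}" using perm by (auto simp: is_perm_def)
  have "?s permutes {1..max n (Suc i)}" using i by (intro permutes_swap_id) auto
  moreover have "w permutes {1..max n (Suc i)}" by (rule permutes_subset [OF n]) auto
  ultimately have perm': "is_perm ?w" unfolding is_perm_def using permutes_compose by blast
  moreover have "lehmer_code ?w k = c' k" if k: "1 \<le> k" for k
  proof -
    consider "k < i" | "k = i" | "k = Suc i" | "Suc i < k" by linarith
    then show ?thesis
    proof cases
      case 1
      have eq: "{j. k < j \<and> ?w j < w k} = ?s ` {j. k < j \<and> w j < w k}"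
      proof (intro subset_antisym subsetI)
        fix j assume "j \<in> {j. k < j \<and> ?w j < w k}"
        then have "?s j \<in> {j. k < j \<and> w j < w k}" using 1 by (auto simp: transpose_def)
        then have "?s (?s j) \<in> ?s ` {j. k < j \<and> w j < w k}" by (rule imageI)
        then show "j \<in> ?s ` {j. k < j \<and> w j < w k}" by simp
      next
        fix j assume "j \<in> ?s ` {j. k < j \<and> w j < w k}"
        then show "j \<in> {j. k < j \<and> ?w j < w k}" using 1 by (auto simp: transpose_def)
      qed
      have "card {j. k < j \<and> ?w j < w k} = card {j. k < j \<and> w j < w k}"
        unfolding eq by (intro card_image) (auto intro: inj_on_subset [OF inj_transpose])
      then show ?thesis using 1 vals(3) [of k] c [OF k] c' [OF k] by (simp add: lehmer_code_def)
    next
      case 2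
      have "{j. i < j \<and> ?w j < ?w i} = {j. Suc i < j \<and> w j < w (Suc i)}" (is "?A = ?B")
      proof (intro subset_antisym subsetI)
        fix j assume j: "j \<in> ?A"
        then have "j \<noteq> Suc i" using vals(1,2) desc by auto
        then show "j \<in> ?B" using j vals(1) vals(3) [of j] by auto
      next
        fix j assume j: "j \<in> ?B"
        then show "j \<in> ?A" using vals(1) vals(3) [of j] by auto
      qed
      then show ?thesis using 2 c [of "Suc i"] c' [OF k] by (simp only: lehmer_code_def) simp
    next
      case 3
      have "{j. i < j \<and> w j < w i} = insert (Suc i) {j. Suc i < j \<and> ?w j < ?w (Suc i)}"
        (is "?A = insert _ ?B")
      proof (intro subset_antisym subsetI)
        fix j assume j: "j \<in> ?A"
        then show "j \<in> insert (Suc i) ?B" using vals(2) vals(3) [of j] by auto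
      next
        fix j assume j: "j \<in> insert (Suc i) ?B"
        then show "j \<in> ?A" using vals(2) vals(3) [of j] desc by auto
      qed
      moreover have "finite ?B" by (rule finite_lehmer_set [OF perm'])
      ultimately have "lehmer_code w i = Suc (lehmer_code ?w (Suc i))"
        by (simp only: lehmer_code_def) simp
      then show ?thesis using 3 c [OF i] c' [OF k] by simp
    next
      case 4
      have "{j. k < j \<and> ?w j < ?w k} = {j. k < j \<and> w j < w k}" (is "?A = ?B")
      proof (intro subset_antisym subsetI)
        fix j assume j: "j \<in> ?A"
        then show "j \<in> ?B" using vals(3) [of j] vals(3) [of k] 4 by auto
      next
        fix j assume j: "j \<in> ?B"
        then show "j \<in> ?A" using vals(3) [of j] vals(3) [of k] 4 by auto
      qed
      then show ?thesis using 4 c [OF k] c' [OF k] by (simp only: lehmer_code_def) simp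
    qed
  qed
  ultimately show ?thesis by (simp add: has_code_def)
qed

lemma longest_perm_permutes: "longest_perm n permutes {1..n}"
proof -
  have "longest_perm n (longest_perm n i) = i" for i
    by (auto simp: longest_perm_def)
  then have "\<exists>!i. longest_perm n i = j" for j by metis
  then show ?thesis by (simp add: permutes_def longest_perm_def)
qed

lemma has_code_longest_perm: "has_code (longest_perm n) (\<lambda>i. n - i)"
proof -
  have "lehmer_code (longest_perm n) i = n - i" if "1 \<le> i" for i
  proof -
    have "{j. i < j \<and> longest_perm n j < longest_perm n i} = {i<..n}"
      using that by (auto simp: longest_perm_def split: if_splits)
    then show ?thesis by (simp add: lehmer_code_def)
  qed
  then show ?thesis using longest_perm_permutes by (auto simp: has_code_def is_perm_def)
qed

text \<open>Let \<open>p\<close> be the first position after \<open>a\<close> whose value exceeds \<open>w c\<close>. Then \<open>w (p - 1) < w c < w p\<close>, so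
\<open>p - 1\<close> and \<open>p\<close> form an ascent whose values are separated by the value at the later position \<open>c\<close>.
Position \<open>c\<close> is counted by the code at \<open>p\<close> but not at \<open>p - 1\<close>, which forces the code to increase. The lower
bound \<open>m\<close> on positions is needed for codes that decrease only after their first entry.\<close>

lemma no_132_if_code_decreasing:
  assumes w: "is_perm w" and dec: "\<And>i. m \<le> i \<Longrightarrow> lehmer_code w (Suc i) \<le> lehmer_code w i"
    and pos: "m \<le> a" "a < b" "b < c" and val: "w a < w c" "w c < w b"
  shows False
proof -
  define p where "p = (LEAST p. a < p \<and> w c < w p)"
  have p: "a < p" "w c < w p" and least: "\<And>q. a < q \<Longrightarrow> w c < w q \<Longrightarrow> p \<le> q"
    using LeastI [of "\<lambda>p. a < p \<and> w c < w p" b] Least_le [of "\<lambda>p. a < p \<and> w c < w p"] pos val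
    by (auto simp: p_def)
  have "p \<le> b" using least pos val by blast
  obtain q where q: "p = Suc q" using p(1) by (cases p) auto
  have "w q < w c"
  proof (rule ccontr)
    assume "\<not> w q < w c"
    moreover have "w q \<noteq> w c"
      using \<open>p \<le> b\<close> q pos by (simp add: inj_eq [OF bij_is_inj [OF is_perm_bij [OF w]]])
    ultimately have "w c < w q" by simp
    moreover have "a < q" using calculation val(1) p(1) q by (cases "a = q") auto
    ultimately show False using least q by fastforce
  qed
  have "{j. q < j \<and> w j < w q} \<subset> {j. p < j \<and> w j < w p}"
  proof
    show "{j. q < j \<and> w j < w q} \<subseteq> {j. p < j \<and> w j < w p}"
    proof
      fix j assume j: "j \<in> {j. q < j \<and> w j < w q}"
      then have "j \<noteq> p" using \<open>w q < w c\<close> p(2) by auto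
      then show "j \<in> {j. p < j \<and> w j < w p}" using j q \<open>w q < w c\<close> p(2) by auto
    qed
    have "c \<in> {j. p < j \<and> w j < w p} - {j. q < j \<and> w j < w q}"
      using p(2) \<open>w q < w c\<close> \<open>p \<le> b\<close> pos by auto
    then show "{j. q < j \<and> w j < w q} \<noteq> {j. p < j \<and> w j < w p}" by blast
  qed
  then have "lehmer_code w q < lehmer_code w p"
    unfolding lehmer_code_def by (rule psubset_card_mono [OF finite_lehmer_set [OF w]])
  then show False using dec [of q] p(1) pos(1) q by auto
qed

lemma dominant_if_partition_code:
  assumes "has_code w lam" "is_partition lam"
  shows "dominant w"
proof -
  have w: "is_perm w" "\<And>i. 1 \<le> i \<Longrightarrow> lehmer_code w i = lam i" using assms(1) by (simp_all add: has_code_def)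
  have "lehmer_code w (Suc i) \<le> lehmer_code w i" if "1 \<le> i" for i
    using w(2) that partition_antimono [OF assms(2) that, of "Suc i"] by simp
  then show ?thesis unfolding dominant_def using no_132_if_code_decreasing [OF w(1), of 1] by blast
qed

text \<open>The first entry of the code is zero, so \<open>w 1\<close> is the smallest value and cannot take part in a
2143-pattern as its first letter. From the second position on the code decreases, which excludes the
132-pattern formed by the letters \<open>2\<close>, \<open>4\<close>, \<open>3\<close>.\<close>

lemma vexillary_if_hat_code:
  assumes "has_code w (hat_code lam)" "is_partition lam"
  shows "vexillary w"
proof -
  have w: "is_perm w" "\<And>i. 1 \<le> i \<Longrightarrow> lehmer_code w i = hat_code lam i"
    using assms(1) by (simp_all add: has_code_def)
  have dec: "lehmer_code w (Suc i) \<le> lehmer_code w i" if "2 \<le> i" for i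
    using w(2) [of i] w(2) [of "Suc i"] that partition_antimono [OF assms(2), of i "Suc i"]
    by (simp add: hat_code_def diff_le_mono)
  have first: "\<not> w b < w 1" if "1 < b" for b
  proof
    assume "w b < w 1"
    moreover have "lehmer_code w 1 = 0" using w(2) [of 1] by (simp add: hat_code_def)
    then have "{j. 1 < j \<and> w j < w 1} = {}"
      using finite_lehmer_set [OF w(1)] unfolding lehmer_code_def by (simp only: card_0_eq)
    ultimately show False using that by blast
  qed
  show ?thesis unfolding vexillary_def
  proof (intro notI, elim exE conjE)
    fix a b c d
    assume pos: "1 \<le> a" "a < b" "b < c" "c < d" and val: "w b < w a" "w a < w d" "w d < w c"
    have "a \<noteq> 1" using first [of b] pos val by auto
    then have "2 \<le> a" using pos by simp
    then show False
      using no_132_if_code_decreasing [OF w(1) dec, of 2 a c d] pos val by simp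
  qed
qed


section \<open>Double Schubert polynomials are well defined\<close>

definition diagram_prod :: "(nat \<Rightarrow> nat) \<Rightarrow> mpoly" where
  "diagram_prod lam = (\<Prod>(i, j) \<in> {(i, j). 1 \<le> i \<and> 1 \<le> j \<and> j \<le> lam i}. pvar (X i) - pvar (Y j))"

text \<open>The defining relation with the symmetric group fixed. For fixed \<open>n\<close> there is only one starting point, so
that uniqueness becomes a confluence statement; the passage from \<open>n\<close> to \<open>n + 1\<close> is treated separately.\<close>

inductive schubert_in :: "nat \<Rightarrow> (nat \<Rightarrow> nat) \<Rightarrow> mpoly \<Rightarrow> bool" for n where
  longest: "schubert_in n (longest_perm n) (diagram_prod (\<lambda>i. n - i))"
| step: "schubert_in n w f \<Longrightarrow> 1 \<le> i \<Longrightarrow> w (Suc i) < w i \<Longrightarrow>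
     schubert_in n (w \<circ> transpose i (Suc i)) (divided_difference i f)"

lemma descent_bound:
  assumes "w permutes {1..n}" "1 \<le> i" "w (Suc i) < w i"
  shows "Suc i \<le> n"
proof (rule ccontr)
  assume "\<not> Suc i \<le> n"
  then have "w (Suc i) = Suc i" using assms(1) by (auto simp: permutes_def)
  moreover have "w i \<le> i"
  proof (cases "i \<le> n")
    case True
    then have "w i \<in> {1..n}" using permutes_in_image [OF assms(1)] assms(2) by simp
    then show ?thesis using \<open>\<not> Suc i \<le> n\<close> by simp
  next
    case False
    then show ?thesis using assms(1) by (auto simp: permutes_def)
  qed
  ultimately show False using assms(3) by simp
qed

lemma permutes_swap:
  assumes "w permutes {1..n}" "1 \<le> i" "Suc i \<le> n"
  shows "w \<circ> transpose i (Suc i) permutes {1..n}"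
  using permutes_compose [OF permutes_swap_id assms(1)] assms(2,3) by simp

lemma schubert_in_permutes: "schubert_in n w f \<Longrightarrow> w permutes {1..n}"
proof (induction rule: schubert_in.induct)
  case longest
  show ?case by (rule longest_perm_permutes)
next
  case (step w f i)
  then show ?case using permutes_swap descent_bound by blast
qed

text \<open>A quantity that grows with every step of a derivation from the longest permutation. It serves as a
well-founded measure in place of the number of non-inversions, since its change under an adjacent
transposition is immediate.\<close>

definition position_moment :: "nat \<Rightarrow> (nat \<Rightarrow> nat) \<Rightarrow> nat" where
  "position_moment n w = (\<Sum>i = 1..n. i * w i)"

lemma position_moment_swap:
  assumes i: "1 \<le> i" "Suc i \<le> n" and asc: "w i < w (Suc i)"
  shows "position_moment n (w \<circ> transpose i (Suc i)) < position_moment n w"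
proof -
  let ?w = "w \<circ> transpose i (Suc i)"
  have split: "position_moment n v = (\<Sum>k\<in>{1..n} - {i, Suc i}. k * v k) + (i * v i + Suc i * v (Suc i))" for v
    unfolding position_moment_def using i by (subst sum.subset_diff [of "{i, Suc i}"]) auto
  have "(\<Sum>k\<in>{1..n} - {i, Suc i}. k * ?w k) = (\<Sum>k\<in>{1..n} - {i, Suc i}. k * w k)"
    by (intro sum.cong) (auto simp: transpose_def)
  moreover have "i * ?w i + Suc i * ?w (Suc i) < i * w i + Suc i * w (Suc i)"
    using asc by simp
  ultimately show ?thesis unfolding split [of ?w] split [of w] by linarith
qed

lemma no_ascents_imp_longest:
  assumes w: "w permutes {1..n}"
    and desc: "\<And>i. 1 \<le> i \<Longrightarrow> Suc i \<le> n \<Longrightarrow> w (Suc i) < w i"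
  shows "w = longest_perm n"
proof
  fix i
  have range: "w k \<in> {1..n}" if "k \<in> {1..n}" for k
    using permutes_in_image [OF w] that by simp
  show "w i = longest_perm n i"
  proof (cases "i \<in> {1..n}")
    case True
    have upper: "w k + k \<le> n + 1" if "1 \<le> k" "k \<le> n" for k
      using that
    proof (induction k rule: dec_induct)
      case base
      then show ?case using range [of 1] by simp
    next
      case (step k)
      then show ?case using desc [of k] by simp
    qed
    have lower: "d < n \<Longrightarrow> d + 1 \<le> w (n - d)" for d
    proof (induction d)
      case 0
      then show ?case using range [of n] by simp
    next
      case (Suc d)
      have "w (Suc (n - Suc d)) < w (n - Suc d)" using Suc.prems by (intro desc) auto
      moreover have "Suc (n - Suc d) = n - d" using Suc.prems by simp
      ultimately show ?case using Suc by simp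
    qed
    show ?thesis using upper [of i] lower [of "n - i"] True by (simp add: longest_perm_def)
  next
    case False
    then show ?thesis using w by (auto simp: longest_perm_def permutes_def)
  qed
qed

lemma schubert_in_total:
  assumes "w permutes {1..n}"
  shows "\<exists>f. schubert_in n w f"
  using assms
proof (induction "position_moment n w" arbitrary: w rule: less_induct)
  case less
  show ?case
  proof (cases "\<exists>i. 1 \<le> i \<and> Suc i \<le> n \<and> w i < w (Suc i)")
    case True
    then obtain i where i: "1 \<le> i" "Suc i \<le> n" "w i < w (Suc i)" by blast
    let ?w = "w \<circ> transpose i (Suc i)"
    obtain f where "schubert_in n ?w f"
      using less.hyps [OF position_moment_swap permutes_swap] i less.prems by blast
    moreover have "?w (Suc i) < ?w i" using i by simp
    ultimately have "schubert_in n (?w \<circ> transpose i (Suc i)) (divided_difference i f)"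
      using i(1) by (rule_tac schubert_in.step)
    moreover have "?w \<circ> transpose i (Suc i) = w" by (simp add: fun_eq_iff)
    ultimately show ?thesis by auto
  next
    case False
    have "w (Suc i) < w i" if "1 \<le> i" "Suc i \<le> n" for i
    proof -
      have "w i \<noteq> w (Suc i)"
        using inj_eq [OF permutes_inj [OF less.prems]] by simp
      moreover have "\<not> w i < w (Suc i)" using False that by blast
      ultimately show ?thesis by simp
    qed
    then have "w = longest_perm n" by (rule no_ascents_imp_longest [OF less.prems])
    then show ?thesis using schubert_in.longest by blast
  qed
qed

lemma schubert_in_cases:
  assumes "schubert_in n w f"
  obtains "w = longest_perm n" "f = diagram_prod (\<lambda>i. n - i)"
  | i f' where "1 \<le> i" "Suc i \<le> n" "w i < w (Suc i)"
      "schubert_in n (w \<circ> transpose i (Suc i)) f'" "f = divided_difference i f'"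
  using assms
proof cases
  case longest
  then show ?thesis using that(1) by simp
next
  case (step w' f' i)
  have "w \<circ> transpose i (Suc i) = w'" using step(1) by (simp add: fun_eq_iff)
  then show ?thesis
    using that(2) [of i f'] step descent_bound [OF schubert_in_permutes [OF step(3)] step(4,5)] by simp
qed

lemma schubert_in_step_from:
  assumes "schubert_in n u h" "1 \<le> i" "u (Suc i) < u i" "w = u \<circ> transpose i (Suc i)"
  shows "schubert_in n w (divided_difference i h)"
  using assms schubert_in.step by blast

text \<open>Suppose that two derivations of \<open>w\<close> end with \<open>\<partial>\<^sub>i\<close> and \<open>\<partial>\<^sub>j\<close>, where \<open>i \<noteq> j\<close>. Then \<open>w\<close> has ascents at \<open>i\<close> and at \<open>j\<close>.
Reversing \<open>w\<close> on the positions concerned yields a permutation \<open>u\<close> from which both \<open>w s\<^sub>i\<close> and \<open>w s\<^sub>j\<close> are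
reached. By totality \<open>u\<close> has some polynomial \<open>h\<close>, and by induction the polynomials of \<open>w s\<^sub>i\<close> and \<open>w s\<^sub>j\<close>
are divided differences of \<open>h\<close>. The relations between divided differences finish the proof.\<close>

lemma schubert_in_unique:
  "schubert_in n w f \<Longrightarrow> schubert_in n w g \<Longrightarrow> f = g"
proof (induction "position_moment n w" arbitrary: w f g rule: less_induct)
  case less
  let ?s = "\<lambda>i. transpose i (Suc i)"
  note perm = schubert_in_permutes [OF less.prems(1)]
  have IH: "f' = g'" if "1 \<le> i" "Suc i \<le> n" "w i < w (Suc i)"
    "schubert_in n (w \<circ> ?s i) f'" "schubert_in n (w \<circ> ?s i) g'" for i f' g'
    using less.hyps [OF position_moment_swap [OF that(1-3)] that(4,5)] .
  have longest: "\<not> w i < w (Suc i)" if "w = longest_perm n" "1 \<le> i" "Suc i \<le> n" for i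
    using that by (simp add: longest_perm_def)
  have braid: "divided_difference i f' = divided_difference (Suc i) g'"
    if i: "1 \<le> i" "Suc (Suc i) \<le> n" and asc: "w i < w (Suc i)" "w (Suc i) < w (Suc (Suc i))"
      and f': "schubert_in n (w \<circ> ?s i) f'" and g': "schubert_in n (w \<circ> ?s (Suc i)) g'" for i f' g'
  proof -
    define u where "u = w \<circ> ?s i \<circ> ?s (Suc i) \<circ> ?s i"
    have vals: "u i = w (Suc (Suc i))" "u (Suc i) = w (Suc i)" "u (Suc (Suc i)) = w i"
      by (simp_all add: u_def transpose_def)
    have "u permutes {1..n}"
      unfolding u_def using perm i by (intro permutes_swap) auto
    then obtain h where h: "schubert_in n u h" using schubert_in_total by blast
    have "schubert_in n (u \<circ> ?s i) (divided_difference i h)"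
      using h i vals asc by (intro schubert_in_step_from [OF h]) auto
    then have "schubert_in n (w \<circ> ?s i) (divided_difference (Suc i) (divided_difference i h))"
      by (rule schubert_in_step_from)
         (use vals asc i in \<open>simp_all add: transpose_def u_def fun_eq_iff\<close>)
    then have f'_eq: "f' = divided_difference (Suc i) (divided_difference i h)"
      using IH [of i] i asc f' by simp
    have "schubert_in n (u \<circ> ?s (Suc i)) (divided_difference (Suc i) h)"
      using h i vals asc by (intro schubert_in_step_from [OF h]) auto
    then have "schubert_in n (w \<circ> ?s (Suc i)) (divided_difference i (divided_difference (Suc i) h))"
      by (rule schubert_in_step_from)
         (use vals asc i in \<open>simp_all add: transpose_def u_def fun_eq_iff\<close>)
    then have g'_eq: "g' = divided_difference i (divided_difference (Suc i) h)"
      using IH [of "Suc i"] i asc g' by simp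
    show ?thesis unfolding f'_eq g'_eq by (rule divided_difference_braid)
  qed
  have commute: "divided_difference i f' = divided_difference j g'"
    if i: "1 \<le> i" "Suc i < j" "Suc j \<le> n" and asc: "w i < w (Suc i)" "w j < w (Suc j)"
      and f': "schubert_in n (w \<circ> ?s i) f'" and g': "schubert_in n (w \<circ> ?s j) g'" for i j f' g'
  proof -
    define u where "u = w \<circ> ?s i \<circ> ?s j"
    have vals: "u i = w (Suc i)" "u (Suc i) = w i" "u j = w (Suc j)" "u (Suc j) = w j"
      using i by (simp_all add: u_def transpose_def)
    have "u permutes {1..n}"
      unfolding u_def using perm i by (intro permutes_swap) auto
    then obtain h where h: "schubert_in n u h" using schubert_in_total by blast
    have "schubert_in n (w \<circ> ?s i) (divided_difference j h)"
      by (rule schubert_in_step_from [OF h])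
         (use vals asc i in \<open>simp_all add: transpose_def u_def fun_eq_iff\<close>)
    then have f'_eq: "f' = divided_difference j h"
      using IH [of i] i asc f' by simp
    have "schubert_in n (w \<circ> ?s j) (divided_difference i h)"
      by (rule schubert_in_step_from [OF h])
         (use vals asc i in \<open>auto simp: transpose_def u_def fun_eq_iff\<close>)
    then have g'_eq: "g' = divided_difference i h"
      using IH [of j] i asc g' by simp
    show ?thesis unfolding f'_eq g'_eq using i by (intro divided_difference_commute)
  qed
  from less.prems(1) show ?case
  proof (cases rule: schubert_in_cases)
    case f: 1
    from less.prems(2) show ?thesis
    proof (cases rule: schubert_in_cases)
      case 1
      then show ?thesis using f by simp
    next
      case (2 j g')
      then show ?thesis using longest f(1) by blast
    qed
  next
    case f: (2 i f')
    from less.prems(2) show ?thesis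
    proof (cases rule: schubert_in_cases)
      case 1
      then show ?thesis using longest f(1-3) by blast
    next
      case g: (2 j g')
      consider "i = j" | "j = Suc i" | "i = Suc j" | "Suc i < j" | "Suc j < i" by linarith
      then show ?thesis
      proof cases
        case 1
        then show ?thesis using IH [OF f(1-4)] f(5) g(4,5) by simp
      next
        case 2
        then show ?thesis using braid [of i f' g'] f g by simp
      next
        case 3
        then show ?thesis using braid [of j g' f'] f g by simp
      next
        case 4
        then show ?thesis using commute [of i j f' g'] f g by simp
      next
        case 5
        then show ?thesis using commute [of j i g' f'] f g by simp
      qed
    qed
  qed
qed

section \<open>Schubert polynomials indexed by codes\<close>

text \<open>Permutations enter the computation only through their codes, on which the steps act by a simple rule; this
predicate hides them.\<close>

definition schubert_of_code :: "nat \<Rightarrow> (nat \<Rightarrow> nat) \<Rightarrow> mpoly \<Rightarrow> bool" where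
  "schubert_of_code n c f \<longleftrightarrow> (\<exists>w. has_code w c \<and> schubert_in n w f)"

lemma schubert_of_code_step:
  assumes "schubert_of_code n c f" and i: "1 \<le> i" "c (Suc i) < c i"
    and c': "\<And>k. 1 \<le> k \<Longrightarrow> c' k = (c(i := c (Suc i), Suc i := c i - 1)) k"
  shows "schubert_of_code n c' (divided_difference i f)"
proof -
  obtain w where w: "has_code w c" "schubert_in n w f"
    using assms(1) by (auto simp: schubert_of_code_def)
  have "w (Suc i) < w i" using code_descent [OF w(1) i] .
  then show ?thesis
    using has_code_swap [OF w(1) i(1)] schubert_in.step [OF w(2) i(1)] c'
    unfolding schubert_of_code_def by blast
qed

lemma diagram_prod_rows:
  assumes "\<And>i. m < i \<Longrightarrow> lam i = 0"
  shows "diagram_prod lam = (\<Prod>i = 1..m. \<Prod>j = 1..lam i. pvar (X i) - pvar (Y j))"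
proof -
  have "{(i, j). 1 \<le> i \<and> 1 \<le> j \<and> j \<le> lam i} = (SIGMA i:{1..m}. {1..lam i})"
    using assms by (force simp: not_less [symmetric])
  then show ?thesis by (simp add: diagram_prod_def prod.Sigma)
qed

text \<open>The product for \<open>lam\<close> is symmetric in \<open>x\<^sub>i\<close> and \<open>x\<^sub>i\<^sub>+\<^sub>1\<close>, because the two rows have equal length. So only
the linear factor of the additional box is affected, and its divided difference is 1.\<close>

lemma divided_difference_add_box:
  assumes i: "1 \<le> i" and eq: "lam i = lam (Suc i)" and fin: "\<And>k. m < k \<Longrightarrow> lam k = 0" and m: "Suc i \<le> m"
  shows "divided_difference i (diagram_prod (lam(i := Suc (lam i)))) = diagram_prod lam"
proof -
  let ?row = "\<lambda>k. \<Prod>j = 1..lam k. pvar (X k) - pvar (Y j)"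
  let ?rest = "\<Prod>k\<in>{1..m} - {i, Suc i}. ?row k"
  have rows: "diagram_prod lam = prod ?row {1..m}"
    using fin by (rule diagram_prod_rows)
  then have prod_eq: "diagram_prod lam = ?rest * (?row i * ?row (Suc i))"
    using i m prod.subset_diff [of "{i, Suc i}" "{1..m}" ?row] by simp
  have "diagram_prod (lam(i := Suc (lam i))) =
      (\<Prod>k\<in>{1..m}. \<Prod>j = 1..(lam(i := Suc (lam i))) k. pvar (X k) - pvar (Y j))"
    using fin m by (intro diagram_prod_rows) auto
  also have "\<dots> = (\<Prod>k\<in>{1..m}. ?row k * (if k = i then pvar (X i) - pvar (Y (Suc (lam i))) else 1))"
    by (intro prod.cong) auto
  also have "\<dots> = diagram_prod lam * (pvar (X i) - pvar (Y (Suc (lam i))))"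
    using i m by (simp add: prod.distrib rows)
  finally have box: "diagram_prod (lam(i := Suc (lam i))) =
      diagram_prod lam * (pvar (X i) - pvar (Y (Suc (lam i))))" .
  have "swap_vars i ?rest = ?rest"
    unfolding swap_vars_simps(5) by (intro prod.cong) (auto simp: swap_vars_simps(2) swap_vars_pvar_X)
  then have sym: "swap_vars i (diagram_prod lam) = diagram_prod lam"
    unfolding prod_eq using eq
    by (simp add: swap_vars_simps(2,3,5) swap_vars_pvar_X mult.commute)
  show ?thesis
    by (rule divided_difference_eqI)
       (simp add: box swap_vars_simps(2,3) sym swap_vars_pvar_X algebra_simps)
qed

text \<open>Induction on the number of boxes missing from the staircase. If no two adjacent rows among the first \<open>n\<close>
have equal length, the partition is the staircase. Otherwise add a box to the first row \<open>i\<close> that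
has the same length as its successor: the row above is strictly longer, so the shape remains a
partition, and \<open>lam i = lam (i + 1) \<le> n - (i + 1)\<close>, so it remains inside the staircase.\<close>

lemma schubert_of_partition_code:
  assumes dec: "\<And>i. 1 \<le> i \<Longrightarrow> lam (Suc i) \<le> lam i" and bound: "\<And>i. 1 \<le> i \<Longrightarrow> lam i \<le> n - i"
  shows "schubert_of_code n lam (diagram_prod lam)"
  using assms
proof (induction "\<Sum>i = 1..n. n - i - lam i" arbitrary: lam rule: less_induct)
  case less
  show ?case
  proof (cases "\<exists>i. 1 \<le> i \<and> i < n \<and> lam i = lam (Suc i)")
    case True
    define i where "i = (LEAST i. 1 \<le> i \<and> i < n \<and> lam i = lam (Suc i))"
    have i: "1 \<le> i" "i < n" "lam i = lam (Suc i)"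
      using LeastI_ex [OF True] by (auto simp: i_def)
    have least: "i \<le> k" if "1 \<le> k" "k < n" "lam k = lam (Suc k)" for k
      unfolding i_def using that by (intro Least_le) simp
    define lam' where "lam' = lam(i := Suc (lam i))"
    have room: "lam i < n - i" using less.prems(2) [of "Suc i"] i by simp
    have zero: "lam k = 0" if "n < k" for k using less.prems(2) [of k] that by simp
    have "schubert_of_code n lam' (diagram_prod lam')"
    proof (rule less.hyps)
      have "(\<Sum>k = 1..n. n - k - lam' k) < (\<Sum>k = 1..n. n - k - lam k)"
        by (rule sum_strict_mono_strong [of _ i]) (use i room in \<open>auto simp: lam'_def\<close>)
      then show "(\<Sum>k = 1..n. n - k - lam' k) < (\<Sum>k = 1..n. n - k - lam k)" .
    next
      fix k :: nat assume k: "1 \<le> k"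
      show "lam' (Suc k) \<le> lam' k"
      proof (cases "Suc k = i")
        case True
        then have "lam (Suc k) \<noteq> lam k" using least [of k] k i by auto
        then show ?thesis using less.prems(1) [OF k] True by (auto simp: lam'_def)
      next
        case False
        then show ?thesis using less.prems(1) [OF k] by (auto simp: lam'_def)
      qed
      show "lam' k \<le> n - k" using less.prems(2) [OF k] room by (simp add: lam'_def)
    qed
    then have "schubert_of_code n lam (divided_difference i (diagram_prod lam'))"
      by (rule schubert_of_code_step) (use i in \<open>auto simp: lam'_def\<close>)
    then show ?thesis
      using divided_difference_add_box [of i lam n] i zero by (simp add: lam'_def)
  next
    case False
    have strict: "lam (Suc i) < lam i" if "1 \<le> i" "i < n" for i
      using False less.prems(1) [OF that(1)] that by (metis order_le_imp_less_or_eq)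
    have lower: "d < n \<Longrightarrow> d \<le> lam (n - d)" for d
    proof (induction d)
      case (Suc d)
      have "lam (Suc (n - Suc d)) < lam (n - Suc d)" using Suc.prems by (intro strict) auto
      moreover have "Suc (n - Suc d) = n - d" using Suc.prems by simp
      ultimately show ?case using Suc by simp
    qed simp
    have eq: "lam i = n - i" if "1 \<le> i" for i
      using lower [of "n - i"] less.prems(2) [OF that] that by (cases "i \<le> n") auto
    have "{(i, j). 1 \<le> i \<and> 1 \<le> j \<and> j \<le> lam i} = {(i, j). 1 \<le> i \<and> 1 \<le> j \<and> j \<le> n - i}"
      using eq by auto
    then have "diagram_prod lam = diagram_prod (\<lambda>i. n - i)" by (simp add: diagram_prod_def)
    moreover have "has_code (longest_perm n) lam"
      using has_code_longest_perm eq by (rule has_code_cong)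
    ultimately show ?thesis
      unfolding schubert_of_code_def using schubert_in.longest [of n] by metis
  qed
qed

text \<open>The staircase of size \<open>n\<close> is a partition inside the staircase of size \<open>n + 1\<close>, so the product
formula in the larger group already contains the stability of the polynomial of the longest element.\<close>

lemma schubert_in_Suc: "schubert_in n w f \<Longrightarrow> schubert_in (Suc n) w f"
proof (induction rule: schubert_in.induct)
  case longest
  have "schubert_of_code (Suc n) (\<lambda>i. n - i) (diagram_prod (\<lambda>i. n - i))"
    by (rule schubert_of_partition_code) auto
  then obtain w where w: "has_code w (\<lambda>i. n - i)" "schubert_in (Suc n) w (diagram_prod (\<lambda>i. n - i))"
    by (auto simp: schubert_of_code_def)
  have "w = longest_perm n" using w(1) has_code_longest_perm by (rule has_code_unique)
  then show ?case using w(2) by simp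
next
  case (step w f i)
  then show ?case using schubert_in.step by blast
qed

lemma schubert_in_mono: "schubert_in n w f \<Longrightarrow> n \<le> m \<Longrightarrow> schubert_in m w f"
  by (rotate_tac, induction m rule: dec_induct) (auto intro: schubert_in_Suc)

lemma double_schubert_rel_iff: "double_schubert_rel w f \<longleftrightarrow> (\<exists>n. schubert_in n w f)"
proof
  assume "double_schubert_rel w f"
  then show "\<exists>n. schubert_in n w f"
  proof (induction rule: double_schubert_rel.induct)
    case (longest n)
    have "{(i, j). 1 \<le> i \<and> 1 \<le> j \<and> i + j \<le> n} = {(i, j). 1 \<le> i \<and> 1 \<le> j \<and> j \<le> n - i}" by auto
    then show ?case using schubert_in.longest [of n] by (auto simp: diagram_prod_def)
  next
    case (step w f i)
    then show ?case using schubert_in.step by blast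
  qed
next
  assume "\<exists>n. schubert_in n w f"
  then obtain n where "schubert_in n w f" by blast
  then show "double_schubert_rel w f"
  proof (induction rule: schubert_in.induct)
    case longest
    have "{(i, j). 1 \<le> i \<and> 1 \<le> j \<and> i + j \<le> n} = {(i, j). 1 \<le> i \<and> 1 \<le> j \<and> j \<le> n - i}" by auto
    then show ?case using double_schubert_rel.longest [of n] by (simp add: diagram_prod_def)
  next
    case (step w f i)
    then show ?case using double_schubert_rel.step by blast
  qed
qed

theorem double_schubert_eqI:
  assumes "schubert_in n w f"
  shows "double_schubert w = f"
  unfolding double_schubert_def
proof (rule the_equality)
  show "double_schubert_rel w f" using assms double_schubert_rel_iff by blast
  fix g assume "double_schubert_rel w g"
  then obtain m where "schubert_in m w g" using double_schubert_rel_iff by blast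
  then have "schubert_in (max n m) w f" "schubert_in (max n m) w g"
    using assms by (auto intro: schubert_in_mono)
  then show "g = f" by (rule schubert_in_unique [rotated])
qed


section \<open>The vexillary permutation\<close>

definition row_factor :: "nat \<Rightarrow> nat set \<Rightarrow> mpoly" where
  "row_factor k J = (\<Prod>j\<in>J. pvar (X k) - pvar (Y j))"

lemma row_factor_empty [simp]: "row_factor k {} = 1"
  by (simp add: row_factor_def)

lemma row_factor_split:
  "K = I \<union> J \<Longrightarrow> finite I \<Longrightarrow> finite J \<Longrightarrow> I \<inter> J = {} \<Longrightarrow>
     row_factor k K = row_factor k I * row_factor k J"
  by (simp add: row_factor_def prod.union_disjoint)

lemma swap_vars_row_factor:
  "swap_vars i (row_factor i J) = row_factor (Suc i) J"
  "swap_vars i (row_factor (Suc i) J) = row_factor i J"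
  "k \<noteq> i \<Longrightarrow> k \<noteq> Suc i \<Longrightarrow> swap_vars i (row_factor k J) = row_factor k J"
  by (simp_all add: row_factor_def swap_vars_simps(2,5) swap_vars_pvar_X)

text \<open>The sum over paths that start in row \<open>k\<close> and column \<open>a\<close> (columns numbered from the left) and end at the
leftmost cell of row \<open>r\<close>. The summation index \<open>m\<close> is the column in which the path leaves row \<open>k\<close>. A path
contributes the product over the cells it avoids, except those of row \<open>k\<close> to the right of column \<open>a\<close>:
the cells of row \<open>k\<close> to the left of \<open>m\<close>, those of row \<open>k + 1\<close> to the right of \<open>m\<close>, and the cells accounted
for by the rest of the path.\<close>

function path_poly :: "(nat \<Rightarrow> nat) \<Rightarrow> nat \<Rightarrow> nat \<Rightarrow> nat \<Rightarrow> mpoly" where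
  "path_poly lam r k a =
     (if r \<le> k then 1
      else \<Sum>m = 1..min a (lam (Suc k)).
        row_factor k {1..<m} * row_factor (Suc k) {m<..lam (Suc k)} * path_poly lam r (Suc k) m)"
  by auto
termination by (relation "measure (\<lambda>(lam, r, k, a). r - k)") auto

declare path_poly.simps [simp del]

lemma path_poly_last [simp]: "path_poly lam r r a = 1"
  by (simp add: path_poly.simps)

lemma path_poly_unfold:
  "k < r \<Longrightarrow> path_poly lam r k a = (\<Sum>m = 1..min a (lam (Suc k)).
        row_factor k {1..<m} * row_factor (Suc k) {m<..lam (Suc k)} * path_poly lam r (Suc k) m)"
  by (subst path_poly.simps) simp

lemma swap_vars_path_poly:
  "Suc i < k \<Longrightarrow> swap_vars i (path_poly lam r k a) = path_poly lam r k a"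
proof (induction lam r k a rule: path_poly.induct)
  case (1 lam r k a)
  show ?case
  proof (cases "r \<le> k")
    case True
    then show ?thesis by (simp add: path_poly.simps)
  next
    case False
    then show ?thesis using 1
      by (simp add: path_poly_unfold swap_vars_simps(3,4) swap_vars_row_factor(3))
  qed
qed

text \<open>Replace the variable \<open>x\<^sub>i\<close> by \<open>x\<^sub>i\<^sub>+\<^sub>1\<close> in one linear factor after the other, from the right end of
the interval to the left. Each replacement changes the product by \<open>x\<^sub>i - x\<^sub>i\<^sub>+\<^sub>1\<close> times a summand.\<close>

lemma divided_difference_row_factor:
  assumes "b \<le> Suc L"
  shows "divided_difference i (row_factor i {b..L}) =
     (\<Sum>m = b..L. row_factor i {b..<m} * row_factor (Suc i) {m<..L})"
proof (rule divided_difference_eqI)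
  define T where "T m = row_factor i {b..<m} * row_factor (Suc i) {m..L}" for m
  have step: "(pvar (X i) - pvar (X (Suc i))) * (row_factor i {b..<m} * row_factor (Suc i) {m<..L})
      = T (Suc m) - T m" if m: "m \<in> {b..L}" for m
  proof -
    have "{b..<Suc m} = insert m {b..<m}" "{m..L} = insert m {m<..L}" "{Suc m..L} = {m<..L}"
      using m by auto
    then show ?thesis
      by (simp add: T_def row_factor_def algebra_simps)
  qed
  have "(pvar (X i) - pvar (X (Suc i))) *
      (\<Sum>m = b..L. row_factor i {b..<m} * row_factor (Suc i) {m<..L}) = (\<Sum>m = b..L. T (Suc m) - T m)"
    unfolding sum_distrib_left using step by (intro sum.cong) auto
  also have "\<dots> = T (Suc L) - T b" using assms by (rule sum_Suc_diff)
  also have "\<dots> = row_factor i {b..L} - swap_vars i (row_factor i {b..L})"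
    by (simp add: T_def swap_vars_row_factor atLeastLessThanSuc_atLeastAtMost)
  finally show "(pvar (X i) - pvar (X (Suc i))) *
      (\<Sum>m = b..L. row_factor i {b..<m} * row_factor (Suc i) {m<..L}) =
      row_factor i {b..L} - swap_vars i (row_factor i {b..L})" .
qed

text \<open>Expand the paths of the rows from \<open>k + 1\<close> on by the column \<open>b\<close> in which they leave row \<open>k + 1\<close>. The part
of row \<open>k\<close> to the left of \<open>b\<close> combines with that of row \<open>k + 1\<close> to a factor symmetric in \<open>x\<^sub>k\<close> and
\<open>x\<^sub>k\<^sub>+\<^sub>1\<close>, so the operator acts only on the remaining interval of row \<open>k\<close>. It produces a sum over the column
\<open>m \<ge> b\<close> in which a path enters row \<open>k + 1\<close>; exchanging the two sums gives paths that start in row \<open>k\<close>.\<close>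

lemma divided_difference_path_poly:
  assumes k: "k < r" and dec: "lam (Suc (Suc k)) \<le> lam (Suc k)"
  shows "divided_difference k (row_factor k {1..lam (Suc k)} * path_poly lam r (Suc k) (lam (Suc k)))
     = path_poly lam r k (lam (Suc k))"
proof (cases "Suc k = r")
  case True
  then show ?thesis
    using path_poly_unfold [OF k, of lam "lam (Suc k)"]
      divided_difference_row_factor [of 1 "lam (Suc k)" k] by simp
next
  case False
  define L where "L = lam (Suc k)"
  define L' where "L' = lam (Suc (Suc k))"
  define R where "R b = row_factor (Suc (Suc k)) {b<..L'} * path_poly lam r (Suc (Suc k)) b" for b
  define C where "C b = row_factor k {1..<b} * row_factor (Suc k) {1..<b} * R b" for b
  have L: "L' \<le> L" using dec by (simp add: L_def L'_def)
  have inner: "path_poly lam r (Suc k) a = (\<Sum>b = 1..min a L'. row_factor (Suc k) {1..<b} * R b)" for a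
    using k False path_poly_unfold [of "Suc k" r lam a] by (simp add: R_def L'_def mult.assoc)
  have C: "swap_vars k (C b) = C b" for b
    by (simp add: C_def R_def swap_vars_simps(3) swap_vars_row_factor swap_vars_path_poly mult.commute)
  have "row_factor k {1..L} * path_poly lam r (Suc k) L =
      (\<Sum>b = 1..L'. C b * row_factor k {b..L})"
  proof -
    have "row_factor k {1..L} * (row_factor (Suc k) {1..<b} * R b) = C b * row_factor k {b..L}"
      if "b \<in> {1..L'}" for b
    proof -
      have "row_factor k {1..L} = row_factor k {1..<b} * row_factor k {b..L}"
        by (rule row_factor_split) (use that L in auto)
      then show ?thesis by (simp add: C_def mult_ac)
    qed
    then show ?thesis
      unfolding inner min_absorb2 [OF L] sum_distrib_left by (intro sum.cong refl)
  qed
  then have "divided_difference k (row_factor k {1..L} * path_poly lam r (Suc k) L) =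
      (\<Sum>b = 1..L'. C b * divided_difference k (row_factor k {b..L}))"
    by (simp add: divided_difference_sum divided_difference_mult_symmetric [OF C])
  also have "\<dots> = (\<Sum>b = 1..L'. \<Sum>m\<in>{m \<in> {1..L}. b \<le> m}.
      row_factor k {1..<m} * row_factor (Suc k) {m<..L} * (row_factor (Suc k) {1..<b} * R b))"
  proof (rule sum.cong)
    fix b assume b: "b \<in> {1..L'}"
    have "divided_difference k (row_factor k {b..L}) =
        (\<Sum>m = b..L. row_factor k {b..<m} * row_factor (Suc k) {m<..L})"
      using b L by (intro divided_difference_row_factor) auto
    moreover have "{m \<in> {1..L}. b \<le> m} = {b..L}" using b by auto
    moreover have "C b * (row_factor k {b..<m} * row_factor (Suc k) {m<..L}) =
        row_factor k {1..<m} * row_factor (Suc k) {m<..L} * (row_factor (Suc k) {1..<b} * R b)"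
      if "m \<in> {b..L}" for m
    proof -
      have "row_factor k {1..<m} = row_factor k {1..<b} * row_factor k {b..<m}"
        by (rule row_factor_split) (use that b in auto)
      then show ?thesis by (simp only: C_def mult_ac)
    qed
    ultimately show "C b * divided_difference k (row_factor k {b..L}) =
      (\<Sum>m\<in>{m \<in> {1..L}. b \<le> m}.
      row_factor k {1..<m} * row_factor (Suc k) {m<..L} * (row_factor (Suc k) {1..<b} * R b))"
      by (simp only: sum_distrib_left cong: sum.cong)
  qed simp
  also have "\<dots> = (\<Sum>m = 1..L. \<Sum>b\<in>{b \<in> {1..L'}. b \<le> m}.
      row_factor k {1..<m} * row_factor (Suc k) {m<..L} * (row_factor (Suc k) {1..<b} * R b))"
    by (rule sum.swap_restrict) auto
  also have "\<dots> = (\<Sum>m = 1..L.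
      row_factor k {1..<m} * row_factor (Suc k) {m<..L} * path_poly lam r (Suc k) m)"
  proof (rule sum.cong)
    fix m
    have "{b \<in> {1..L'}. b \<le> m} = {1..min m L'}" by auto
    then show "(\<Sum>b\<in>{b \<in> {1..L'}. b \<le> m}.
        row_factor k {1..<m} * row_factor (Suc k) {m<..L} * (row_factor (Suc k) {1..<b} * R b)) =
      row_factor k {1..<m} * row_factor (Suc k) {m<..L} * path_poly lam r (Suc k) m"
      by (simp add: inner sum_distrib_left)
  qed simp
  also have "\<dots> = path_poly lam r k L"
    using path_poly_unfold [OF k, of lam L] by (simp add: L_def)
  finally show ?thesis by (simp add: L_def)
qed

text \<open>Start from the dominant permutation with code \<open>(lam 2, \<dots>, lam r, 0)\<close> and apply the divided differences
with index \<open>r - 1, \<dots>, 1\<close>. The entry 0 moves to the front and each entry that it passes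
loses one. Before row \<open>k\<close> is reached, the rows above it contribute plain products, which
are symmetric in the variables concerned.\<close>

lemma schubert_of_hat_code:
  assumes lam: "is_partition lam" and zero: "\<And>i. r < i \<Longrightarrow> lam i = 0"
    and pos: "\<And>i. 1 \<le> i \<Longrightarrow> i \<le> r \<Longrightarrow> 0 < lam i" and r: "1 \<le> r"
  shows "schubert_of_code (r + lam 1) (hat_code lam) (path_poly lam r 1 (lam 1))"
proof -
  let ?n = "r + lam 1"
  define code where "code k i = (if i < k then lam (Suc i) else if i = k then 0 else lam i - 1)" for k i
  define poly where "poly k = (\<Prod>i = 1..<k. row_factor i {1..lam (Suc i)}) * path_poly lam r k (lam k)" for k
  have dec: "1 \<le> i \<Longrightarrow> lam (Suc i) \<le> lam i" for i
    by (rule partition_antimono [OF lam]) auto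
  have chain: "1 \<le> k \<Longrightarrow> k \<le> r \<Longrightarrow> schubert_of_code ?n (code k) (poly k)" for k
  proof (induction "r - k" arbitrary: k)
    case 0
    then have k: "k = r" by simp
    have code_r: "code r i = (if i < r then lam (Suc i) else 0)" for i
      using zero [of i] by (simp add: code_def)
    have "schubert_of_code ?n (code r) (diagram_prod (code r))"
    proof (rule schubert_of_partition_code)
      fix i :: nat assume i: "1 \<le> i"
      show "code r (Suc i) \<le> code r i" using dec [of "Suc i"] by (simp add: code_r)
      have "lam (Suc i) \<le> lam 1" by (rule partition_antimono [OF lam]) auto
      then show "code r i \<le> ?n - i" unfolding code_r by auto
    qed
    moreover have "diagram_prod (code r) = (\<Prod>i = 1..r. row_factor i {1..code r i})"
      unfolding row_factor_def by (rule diagram_prod_rows) (simp add: code_r)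
    moreover have "(\<Prod>i = 1..r. row_factor i {1..code r i}) = poly r"
    proof -
      have "{1..r} = insert r {1..<r}" using r by auto
      then show ?thesis by (simp add: poly_def code_r)
    qed
    ultimately show ?case using k by simp
  next
    case (Suc d)
    then have k: "1 \<le> k" "k < r" by auto
    have "schubert_of_code ?n (code (Suc k)) (poly (Suc k))"
      using Suc k by simp
    then have "schubert_of_code ?n (code k) (divided_difference k (poly (Suc k)))"
    proof (rule schubert_of_code_step)
      show "code (Suc k) (Suc k) < code (Suc k) k" using pos [of "Suc k"] k by (simp add: code_def)
    qed (use k in \<open>auto simp: code_def\<close>)
    moreover have "divided_difference k (poly (Suc k)) = poly k"
    proof -
      let ?P = "\<Prod>i = 1..<k. row_factor i {1..lam (Suc i)}"
      have "poly (Suc k) = ?P * (row_factor k {1..lam (Suc k)} * path_poly lam r (Suc k) (lam (Suc k)))"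
        using k by (simp add: poly_def prod.atLeastLessThan_Suc mult.assoc)
      moreover have "swap_vars k ?P = ?P"
        unfolding swap_vars_simps(5) by (intro prod.cong) (auto simp: swap_vars_row_factor(3))
      ultimately have "divided_difference k (poly (Suc k)) = ?P * path_poly lam r k (lam (Suc k))"
        using divided_difference_path_poly [OF k(2) dec [of "Suc k"]]
        by (simp add: divided_difference_mult_symmetric)
      moreover have "path_poly lam r k (lam (Suc k)) = path_poly lam r k (lam k)"
        using dec [OF k(1)] by (simp add: path_poly_unfold [OF k(2)] min_absorb2)
      ultimately show ?thesis by (simp add: poly_def)
    qed
    ultimately show ?case by simp
  qed
  have "schubert_of_code ?n (code 1) (poly 1)" using chain [of 1] r by simp
  moreover have "poly 1 = path_poly lam r 1 (lam 1)" by (simp add: poly_def)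
  moreover have "has_code w (code 1) \<Longrightarrow> has_code w (hat_code lam)" for w
    by (erule has_code_cong) (auto simp: code_def hat_code_def)
  ultimately show ?thesis by (auto simp: schubert_of_code_def)
qed

section \<open>Reversing the columns\<close>

lemma reverse_cols_invol: "reverse_cols c (reverse_cols c v) = v"
  by (cases v) (auto simp: reverse_cols_def)

text \<open>The ring homomorphism through which the Schubert polynomials enter the quotient formula; it identifies the
\<open>j\<close>-th column from the left with the column of index \<open>c + 1 - j\<close> from the right.\<close>

definition reversed_rf :: "nat \<Rightarrow> mpoly \<Rightarrow> ratfun" where
  "reversed_rf c f = rf (subst_invol (reverse_cols c) f)"

lemma reversed_rf_simps:
  "reversed_rf c (f + g) = reversed_rf c f + reversed_rf c g"
  "reversed_rf c (f - g) = reversed_rf c f - reversed_rf c g"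
  "reversed_rf c (f * g) = reversed_rf c f * reversed_rf c g"
  "reversed_rf c (prod h A) = (\<Prod>x\<in>A. reversed_rf c (h x))"
  "reversed_rf c (pvar v) = rvar (reverse_cols c v)"
  by (simp_all add: reversed_rf_def rf_add rf_diff rf_mult rf_prod rvar_def
      subst_invol_add [OF reverse_cols_invol] subst_invol_diff [OF reverse_cols_invol]
      subst_invol_mult [OF reverse_cols_invol] subst_invol_prod [OF reverse_cols_invol]
      subst_invol_pvar [OF reverse_cols_invol])

lemma reversed_rf_0_1: "reversed_rf c 0 = 0" "reversed_rf c 1 = 1"
  using reversed_rf_simps(2) [of c 0 0] reversed_rf_simps(4) [of c _ "{}"] by simp_all

lemma reversed_rf_row_factor_nonzero: "reversed_rf c (row_factor k J) \<noteq> 0"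
proof -
  have "reverse_cols c (X k) \<noteq> reverse_cols c (Y j)" for j by (simp add: reverse_cols_def)
  then have "reversed_rf c (pvar (X k) - pvar (Y j)) \<noteq> 0" for j
    by (simp add: reversed_rf_simps)
  then show ?thesis
    by (cases "finite J") (simp_all add: row_factor_def reversed_rf_simps(4) reversed_rf_0_1)
qed

lemma path_poly_Suc:
  assumes "k < r"
  shows "path_poly lam r k (Suc a) = path_poly lam r k a +
    (if Suc a \<le> lam (Suc k) then row_factor k {1..a} * row_factor (Suc k) {Suc a<..lam (Suc k)} *
       path_poly lam r (Suc k) (Suc a) else 0)"
proof (cases "Suc a \<le> lam (Suc k)")
  case True
  then have "min (Suc a) (lam (Suc k)) = Suc a" "min a (lam (Suc k)) = a" by auto
  then show ?thesis using True
    by (simp add: path_poly_unfold [OF assms] atLeastLessThanSuc_atLeastAtMost)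
next
  case False
  then have "min (Suc a) (lam (Suc k)) = min a (lam (Suc k))" by auto
  then show ?thesis using False by (simp add: path_poly_unfold [OF assms])
qed

text \<open>Column \<open>Suc a\<close> from the left has index \<open>c - a\<close> from the right. Multiplying by the factors of row \<open>k\<close> up to
the starting column and of all rows below clears the denominators of the path sum, and the
recursion by the first step becomes \<open>path_poly_Suc\<close>: a west step lowers \<open>a\<close>, and a south step
leaves the part of row \<open>k\<close> to the left and the part of row \<open>k + 1\<close> to the right unvisited.\<close>

lemma path_sum_eq_path_poly:
  fixes lam :: "nat \<Rightarrow> nat"
  defines "below \<equiv> \<lambda>k r. \<Prod>i\<in>{k<..r}. row_factor i {1..lam i}"
  assumes fin: "finite D"
    and D: "\<And>i j. (i, j) \<in> D \<longleftrightarrow> 1 \<le> i \<and> i \<le> r \<and> 1 \<le> j \<and> j \<le> c \<and> c + 1 - j \<le> lam i"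
    and le: "\<And>i. 1 \<le> i \<Longrightarrow> lam i \<le> c"
  shows "1 \<le> k \<Longrightarrow> k \<le> r \<Longrightarrow> Suc a \<le> lam k \<Longrightarrow>
    path_sum D (k, c - a) (r, c) * reversed_rf c (row_factor k {1..Suc a} * below k r) =
    reversed_rf c (path_poly lam r k (Suc a))"
proof (induction "(r - k) + a" arbitrary: k a rule: less_induct)
  case less
  let ?F = "reversed_rf c"
  have ac: "a < c" using less.prems le [of k] by simp
  have mem: "(k, c - a) \<in> D" using less.prems ac by (auto simp: D)
  have factor: "?F (pvar (X k) - pvar (Y (Suc a))) = cell_factor (k, c - a)"
    using ac by (simp add: reversed_rf_simps reverse_cols_def)
  have split: "row_factor k {1..Suc a} = (pvar (X k) - pvar (Y (Suc a))) * row_factor k {1..a}"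
    by (simp add: row_factor_def atLeastAtMostSuc_conv)
  show ?case
  proof (cases "k = r \<and> a = 0")
    case True
    have "cell_factor (k, c - a) \<noteq> 0" by simp
    moreover have "below k r = 1" using True by (simp add: below_def)
    ultimately show ?thesis
      using True path_sum_end [OF mem] factor split
      by (simp add: reversed_rf_simps(3) reversed_rf_0_1)
  next
    case False
    then have neq: "(k, c - a) \<noteq> (r, c)" using ac by auto
    let ?S = "path_sum D (Suc k, c - a) (r, c)" and ?W = "path_sum D (k, Suc (c - a)) (r, c)"
    have "path_sum D (k, c - a) (r, c) = (?S + ?W) / cell_factor (k, c - a)"
      using path_sum_step [OF fin mem neq] by simp
    moreover have "cell_factor (k, c - a) \<noteq> 0" by simp
    ultimately have "path_sum D (k, c - a) (r, c) * cell_factor (k, c - a) = ?S + ?W"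
      by simp
    then have step: "path_sum D (k, c - a) (r, c) * ?F (row_factor k {1..Suc a} * below k r) =
        ?S * ?F (row_factor k {1..a} * below k r) + ?W * ?F (row_factor k {1..a} * below k r)"
      unfolding split by (simp add: reversed_rf_simps(3) factor mult.assoc [symmetric] distrib_right)
    have W: "?W * ?F (row_factor k {1..a} * below k r) = (if a = 0 then 0 else ?F (path_poly lam r k a))"
    proof (cases a)
      case 0
      then have "(k, Suc (c - a)) \<notin> D" by (simp add: D)
      then show ?thesis using 0 by (simp add: path_sum_outside)
    next
      case (Suc b)
      have "Suc (c - a) = c - b" using Suc ac by simp
      then show ?thesis using less.hyps [of k b] less.prems Suc by simp
    qed
    have S: "?S * ?F (row_factor k {1..a} * below k r) =
        (if k < r \<and> Suc a \<le> lam (Suc k) then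
          ?F (row_factor k {1..a} * row_factor (Suc k) {Suc a<..lam (Suc k)} *
             path_poly lam r (Suc k) (Suc a)) else 0)"
    proof (cases "k < r \<and> Suc a \<le> lam (Suc k)")
      case True
      have "{k<..r} = insert (Suc k) {Suc k<..r}" using True by auto
      then have "below k r = row_factor (Suc k) {1..lam (Suc k)} * below (Suc k) r"
        by (simp add: below_def)
      moreover have "row_factor (Suc k) {1..lam (Suc k)} =
          row_factor (Suc k) {1..Suc a} * row_factor (Suc k) {Suc a<..lam (Suc k)}"
        by (rule row_factor_split) (use True in auto)
      moreover have "?S * ?F (row_factor (Suc k) {1..Suc a} * below (Suc k) r) =
          ?F (path_poly lam r (Suc k) (Suc a))"
        using True less.prems by (intro less.hyps) auto
      ultimately show ?thesis using True by (simp add: reversed_rf_simps(3) mult_ac)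
    next
      case out: False
      then have "(Suc k, c - a) \<notin> D" using ac by (auto simp: D)
      then have "?S = 0" by (rule path_sum_outside)
      then show ?thesis using out by (simp only: if_False mult_zero_left)
    qed
    show ?thesis
    proof (cases "k = r")
      case True
      then show ?thesis unfolding step W S using False by simp
    next
      case neq: False
      then have "k < r" using less.prems by simp
      moreover have "path_poly lam r k 0 = 0"
        using \<open>k < r\<close> by (simp add: path_poly_unfold)
      ultimately show ?thesis unfolding step W S
        by (simp add: path_poly_Suc reversed_rf_simps(1) reversed_rf_0_1)
    qed
  qed
qed

section \<open>Ferrers diagrams\<close>

lemma straight_diagram:
  assumes lam: "is_partition lam" and mu: "\<forall>i\<ge>1. mu i = 0" and ne: "skew_diagram lam mu \<noteq> {}"
    and r: "r = num_rows lam mu" and c: "c = num_cols lam mu"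
  shows "c = lam 1" "1 \<le> r" "\<And>i. r < i \<Longrightarrow> lam i = 0" "\<And>i. 1 \<le> i \<Longrightarrow> i \<le> r \<Longrightarrow> 0 < lam i"
    "\<And>i j. (i, j) \<in> skew_diagram lam mu \<longleftrightarrow> 1 \<le> i \<and> i \<le> r \<and> 1 \<le> j \<and> j \<le> c \<and> c + 1 - j \<le> lam i"
proof -
  have cells: "(i, k) \<in> cells lam mu \<longleftrightarrow> 1 \<le> i \<and> 1 \<le> k \<and> k \<le> lam i" for i k
    using mu by (auto simp: cells_def)
  have fin: "finite (cells lam mu)" by (rule finite_cells [OF lam])
  obtain i k where "(i, k) \<in> cells lam mu" using ne by (auto simp: skew_diagram_def)
  then have "1 \<le> lam 1" using cells partition_antimono [OF lam, of 1 i] by fastforce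
  then have 1: "(1, 1) \<in> cells lam mu" "(1, lam 1) \<in> cells lam mu" by (auto simp: cells)
  then have nonempty: "cells lam mu \<noteq> {}" by blast
  have top: "top_row lam mu = 1"
  proof -
    have "1 \<le> top_row lam mu"
      unfolding top_row_def using fin nonempty by (subst Min_ge_iff) (auto simp: cells)
    then show ?thesis using cells_bounds(1) [OF lam 1(1)] by simp
  qed
  have right: "right_col lam mu = lam 1"
  proof -
    have "k \<le> lam 1" if "(i, k) \<in> cells lam mu" for i k
      using that cells partition_antimono [OF lam, of 1 i] by fastforce
    then have "right_col lam mu \<le> lam 1"
      unfolding right_col_def using fin nonempty by (subst Max_le_iff) auto
    then show ?thesis using cells_bounds(4) [OF lam 1(2)] by simp
  qed
  have left: "Min (snd ` cells lam mu) = 1"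
  proof -
    have "1 \<le> Min (snd ` cells lam mu)"
      using fin nonempty by (subst Min_ge_iff) (auto simp: cells)
    then show ?thesis using cells_bounds(3) [OF lam 1(1)] by simp
  qed
  show c_eq: "c = lam 1" using c right left by (simp add: num_cols_def)
  have r_eq: "r = Max (fst ` cells lam mu)" using r top by (simp add: num_rows_def)
  show "1 \<le> r" using cells_bounds(2) [OF lam 1(1)] r_eq by simp
  show zero: "lam i = 0" if "r < i" for i
  proof (rule ccontr)
    assume "lam i \<noteq> 0"
    then have "(i, 1) \<in> cells lam mu" using that by (auto simp: cells)
    then show False using cells_bounds(2) [OF lam] r_eq that by fastforce
  qed
  have "r \<in> fst ` cells lam mu" unfolding r_eq using fin nonempty by (intro Max_in) auto
  then have "0 < lam r" by (auto simp: cells)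
  then show "0 < lam i" if "1 \<le> i" "i \<le> r" for i
    using partition_antimono [OF lam that] by simp
  show "(i, j) \<in> skew_diagram lam mu \<longleftrightarrow> 1 \<le> i \<and> i \<le> r \<and> 1 \<le> j \<and> j \<le> c \<and> c + 1 - j \<le> lam i" for i j
  proof -
    have "i \<le> r" if "1 \<le> lam i" using zero [of i] that by (cases "i \<le> r") auto
    then show ?thesis
      by (auto simp: skew_diagram_iff [OF lam] top right c_eq cells)
  qed
qed

theorem theoremB:
  fixes lam mu :: "nat \<Rightarrow> nat" and D :: "(nat \<times> nat) set" and r c :: nat
  assumes "is_partition lam" and "is_partition mu" and "\<forall>i\<ge>1. mu i \<le> lam i"
    and "D = skew_diagram lam mu" and "D \<noteq> {}"
    and "r = num_rows lam mu" and "c = num_cols lam mu"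
  shows "Psi (poset_elements r c) (poset_order D) =
           (\<Sum>p \<in> lattice_paths D r c. \<Prod>(i, j) \<in> D - set p. rvar (X i) - rvar (Y j))
           / (\<Prod>(i, j) \<in> D. rvar (X i) - rvar (Y j))
       \<and> ((\<forall>i\<ge>1. mu i = 0) \<longrightarrow>
           (\<exists>!w. has_code w lam) \<and> (\<exists>!w'. has_code w' (hat_code lam)) \<and>
           (\<forall>w w'. has_code w lam \<and> has_code w' (hat_code lam) \<longrightarrow>
              dominant w \<and> vexillary w' \<and>
              Psi (poset_elements r c) (poset_order D) =
                rf (subst_invol (reverse_cols c) (double_schubert w'))
                / rf (subst_invol (reverse_cols c) (double_schubert w))))"
proof (intro conjI impI)
  have fin: "finite D"
    using skew_diagram_bounds [OF assms(1), of mu] assms(4) finite_subset by blast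
  have Psi: "Psi (poset_elements r c) (poset_order D) = path_sum D (1, 1) (r, c)"
    using assms by (intro Psi_skew_diagram)
  then show "Psi (poset_elements r c) (poset_order D) =
           (\<Sum>p \<in> lattice_paths D r c. \<Prod>(i, j) \<in> D - set p. rvar (X i) - rvar (Y j))
           / (\<Prod>(i, j) \<in> D. rvar (X i) - rvar (Y j))"
    using path_sum_complement [OF fin] by simp
  assume mu: "\<forall>i\<ge>1. mu i = 0"
  note straight = straight_diagram [OF assms(1) mu _ assms(6,7), folded assms(4), OF assms(5)]
  have le: "lam i \<le> c" if "1 \<le> i" for i
    using partition_antimono [OF assms(1), of 1 i] that straight(1) by simp
  have "schubert_of_code (r + lam 1) lam (diagram_prod lam)"
  proof (rule schubert_of_partition_code)
    fix i :: nat assume i: "1 \<le> i"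
    show "lam (Suc i) \<le> lam i" using i by (intro partition_antimono [OF assms(1)]) auto
    show "lam i \<le> r + lam 1 - i" using le [OF i] straight(1) straight(3) [of i] by (cases "i \<le> r") auto
  qed
  then obtain w where w: "has_code w lam" "schubert_in (r + lam 1) w (diagram_prod lam)"
    by (auto simp: schubert_of_code_def)
  have "schubert_of_code (r + lam 1) (hat_code lam) (path_poly lam r 1 (lam 1))"
    using assms(1) straight(3,4,2) by (rule schubert_of_hat_code)
  then obtain w' where w': "has_code w' (hat_code lam)"
    "schubert_in (r + lam 1) w' (path_poly lam r 1 (lam 1))"
    by (auto simp: schubert_of_code_def)
  show "\<exists>!w. has_code w lam" using w(1) has_code_unique by blast
  show "\<exists>!w'. has_code w' (hat_code lam)" using w'(1) has_code_unique by blast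
  have "path_sum D (1, c - (c - 1)) (r, c) *
      reversed_rf c (row_factor 1 {1..Suc (c - 1)} * (\<Prod>i\<in>{1<..r}. row_factor i {1..lam i})) =
      reversed_rf c (path_poly lam r 1 (Suc (c - 1)))"
    using straight(1,2) straight(4) [of 1] le by (intro path_sum_eq_path_poly fin straight(5)) auto
  moreover have "0 < c" using straight(1,2) straight(4) [of 1] by simp
  moreover have rows: "diagram_prod lam = (\<Prod>i = 1..r. row_factor i {1..lam i})"
    unfolding row_factor_def using straight(3) by (rule diagram_prod_rows)
  moreover have "{1..r} = insert 1 {1<..r}" using straight(2) by auto
  ultimately have key: "path_sum D (1, 1) (r, c) * reversed_rf c (diagram_prod lam) =
      reversed_rf c (path_poly lam r 1 (lam 1))"
    using straight(1) by simp
  have "reversed_rf c (diagram_prod lam) \<noteq> 0"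
    unfolding rows reversed_rf_simps(4) by (simp add: reversed_rf_row_factor_nonzero)
  then have "path_sum D (1, 1) (r, c) =
      reversed_rf c (path_poly lam r 1 (lam 1)) / reversed_rf c (diagram_prod lam)"
    using key by (metis nonzero_mult_div_cancel_right)
  then have quotient: "Psi (poset_elements r c) (poset_order D) =
      rf (subst_invol (reverse_cols c) (double_schubert w'))
      / rf (subst_invol (reverse_cols c) (double_schubert w))"
    by (simp add: Psi reversed_rf_def double_schubert_eqI [OF w(2)] double_schubert_eqI [OF w'(2)])
  show "\<forall>w w'. has_code w lam \<and> has_code w' (hat_code lam) \<longrightarrow>
              dominant w \<and> vexillary w' \<and>
              Psi (poset_elements r c) (poset_order D) =
                rf (subst_invol (reverse_cols c) (double_schubert w'))
                / rf (subst_invol (reverse_cols c) (double_schubert w))"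
  proof (intro allI impI conjI; elim conjE)
    fix v v' assume v: "has_code v lam" "has_code v' (hat_code lam)"
    show "dominant v" using v(1) assms(1) by (rule dominant_if_partition_code)
    show "vexillary v'" using v(2) assms(1) by (rule vexillary_if_hat_code)
    have "v = w" "v' = w'" using v w(1) w'(1) has_code_unique by blast+
    then show "Psi (poset_elements r c) (poset_order D) =
        rf (subst_invol (reverse_cols c) (double_schubert v'))
        / rf (subst_invol (reverse_cols c) (double_schubert v))"
      using quotient by simp
  qed
qed

end
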